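(* Let $R$ be a commutative ring and let $M$ and $N$ be $R$-Lie algebras equipped with an action of $M$ on $N$ and an action of $N$ on $M$. Let $M\bowtie N$ be their Peiffer product, with quotient map $q\colon M+N\to M\bowtie N$. Then $q$ is the coequalizer in the category of $R$-Lie algebras of the two morphisms $$\binom{k_{N,M}}{k_{M,N}},\ \ \xi^N_M+\xi^M_N\ \colon\ (N\flat M)+(M\flat N)\longrightarrow M+N .$$
   Context: An $R$-Lie algebra is an $R$-module with an $R$-bilinear bracket satisfying $[x,x]=0$ and the Jacobi identity. $+$ denotes the coproduct (of objects and of morphisms) in the category of $R$-Lie algebras; $M$ and $N$ are identified with their images in $M+N$, and $N+M$ with $M+N$. For $f\colon A\to C$ and $g\colon B\to C$, $\binom{f}{g}\colon A+B\to C$ is the induced morphism. An action of an $R$-Lie algebra $P$ on an $R$-Lie algebra $M$ is an $R$-bilinear map $P\times M\to M$, $(p,m)\mapsto {}^{p}m$, such that ${}^{[p,p']}m={}^{p}({}^{p'}m)-{}^{p'}({}^{p}m)$ and ${}^{p}[m,m']=[{}^{p}m,m']+[m,{}^{p}m']$. $P\flat M$ is the kernel of $\binom{1}{0}\colon P+M\to P$ (equivalently, the ideal of $P+M$ generated by $M$), and $k_{P,M}\colon P\flat M\to P+M$ is its inclusion. An action of $P$ on $M$ corresponds to the internal action $\xi^P_M\colon P\flat M\to M$, the unique Lie algebra morphism with $\xi^P_M(m)=m$ for $m\in M$ and $\xi^P_M([p,x])={}^{p}\big(\xi^P_M(x)\big)$ for $p\in P$, $x\in P\flat M$. Here $\xi^N_M\colon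 N\flat M\to M$ and $\xi^M_N\colon M\flat N\to N$ correspond in this way to the given actions. Peiffer product: $M\bowtie N:=(M+N)/K$, where $K$ is the ideal of $M+N$ generated by the elements ${}^{n}m-[n,m]$ and ${}^{m}n-[m,n]$ for $m\in M$, $n\in N$. *)

theory Defs
  imports "HOL-Algebra.Module" "HOL-Algebra.QuotRing"
begin

section \<open>Lie algebras over a commutative ring\<close>

text \<open>
  As in the library's locale \<^locale>\<open>algebra\<close>, the product of the algebra is the field
  \<^const>\<open>mult\<close> of the module record; here \<open>x \<otimes>\<^bsub>L\<^esub> y\<close> is the Lie bracket \<open>[x, y]\<close>.
  The field \<^const>\<open>one\<close> plays no role.
\<close>

locale lie_algebra = module R L for R (structure) and L (structure) +
  assumes bracket_closed [simp, intro]: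
      "\<lbrakk>x \<in> carrier L; y \<in> carrier L\<rbrakk> \<Longrightarrow> x \<otimes>\<^bsub>L\<^esub> y \<in> carrier L"
    and bracket_add_left:
      "\<lbrakk>x \<in> carrier L; y \<in> carrier L; z \<in> carrier L\<rbrakk> \<Longrightarrow>
        (x \<oplus>\<^bsub>L\<^esub> y) \<otimes>\<^bsub>L\<^esub> z = x \<otimes>\<^bsub>L\<^esub> z \<oplus>\<^bsub>L\<^esub> y \<otimes>\<^bsub>L\<^esub> z"
    and bracket_add_right:
      "\<lbrakk>x \<in> carrier L; y \<in> carrier L; z \<in> carrier L\<rbrakk> \<Longrightarrow>
        x \<otimes>\<^bsub>L\<^esub> (y \<oplus>\<^bsub>L\<^esub> z) = x \<otimes>\<^bsub>L\<^esub> y \<oplus>\<^bsub>L\<^esub> x \<otimes>\<^bsub>L\<^esub> z"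
    and bracket_smult_left:
      "\<lbrakk>r \<in> carrier R; x \<in> carrier L; y \<in> carrier L\<rbrakk> \<Longrightarrow>
        (r \<odot>\<^bsub>L\<^esub> x) \<otimes>\<^bsub>L\<^esub> y = r \<odot>\<^bsub>L\<^esub> (x \<otimes>\<^bsub>L\<^esub> y)"
    and bracket_smult_right:
      "\<lbrakk>r \<in> carrier R; x \<in> carrier L; y \<in> carrier L\<rbrakk> \<Longrightarrow>
        x \<otimes>\<^bsub>L\<^esub> (r \<odot>\<^bsub>L\<^esub> y) = r \<odot>\<^bsub>L\<^esub> (x \<otimes>\<^bsub>L\<^esub> y)"
    and bracket_self: "x \<in> carrier L \<Longrightarrow> x \<otimes>\<^bsub>L\<^esub> x = \<zero>\<^bsub>L\<^esub>"
    and jacobi: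
      "\<lbrakk>x \<in> carrier L; y \<in> carrier L; z \<in> carrier L\<rbrakk> \<Longrightarrow>
        x \<otimes>\<^bsub>L\<^esub> (y \<otimes>\<^bsub>L\<^esub> z) \<oplus>\<^bsub>L\<^esub> y \<otimes>\<^bsub>L\<^esub> (z \<otimes>\<^bsub>L\<^esub> x) \<oplus>\<^bsub>L\<^esub> z \<otimes>\<^bsub>L\<^esub> (x \<otimes>\<^bsub>L\<^esub> y) = \<zero>\<^bsub>L\<^esub>"

text \<open>
  Morphisms are extensional functions on the carrier, so that equality of morphisms is equality
  of functions; composition is \<^const>\<open>compose\<close>.
\<close>

definition lie_hom ::
    "('r, 'x) ring_scheme \<Rightarrow> ('r, 'a) module \<Rightarrow> ('r, 'b) module \<Rightarrow> ('a \<Rightarrow> 'b) set" where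
  "lie_hom R A B = {h \<in> carrier A \<rightarrow>\<^sub>E carrier B.
     (\<forall>x\<in>carrier A. \<forall>y\<in>carrier A. h (x \<oplus>\<^bsub>A\<^esub> y) = h x \<oplus>\<^bsub>B\<^esub> h y) \<and>
     (\<forall>r\<in>carrier R. \<forall>x\<in>carrier A. h (r \<odot>\<^bsub>A\<^esub> x) = r \<odot>\<^bsub>B\<^esub> h x) \<and>
     (\<forall>x\<in>carrier A. \<forall>y\<in>carrier A. h (x \<otimes>\<^bsub>A\<^esub> y) = h x \<otimes>\<^bsub>B\<^esub> h y)}"

definition lie_action ::
    "('r, 'x) ring_scheme \<Rightarrow> ('r, 'p) module \<Rightarrow> ('r, 'm) module \<Rightarrow> ('p \<Rightarrow> 'm \<Rightarrow> 'm) \<Rightarrow> bool" where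
  "lie_action R P M act \<longleftrightarrow>
     (\<forall>p\<in>carrier P. \<forall>m\<in>carrier M. act p m \<in> carrier M) \<and>
     (\<forall>p\<in>carrier P. \<forall>p'\<in>carrier P. \<forall>m\<in>carrier M.
        act (p \<oplus>\<^bsub>P\<^esub> p') m = act p m \<oplus>\<^bsub>M\<^esub> act p' m) \<and>
     (\<forall>p\<in>carrier P. \<forall>m\<in>carrier M. \<forall>m'\<in>carrier M.
        act p (m \<oplus>\<^bsub>M\<^esub> m') = act p m \<oplus>\<^bsub>M\<^esub> act p m') \<and>
     (\<forall>r\<in>carrier R. \<forall>p\<in>carrier P. \<forall>m\<in>carrier M. act (r \<odot>\<^bsub>P\<^esub> p) m = r \<odot>\<^bsub>M\<^esub> act p m) \<and>
     (\<forall>r\<in>carrier R. \<forall>p\<in>carrier P. \<forall>m\<in>carrier M. act p (r \<odot>\<^bsub>M\<^esub> m) = r \<odot>\<^bsub>M\<^esub> act p m) \<and>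
     (\<forall>p\<in>carrier P. \<forall>p'\<in>carrier P. \<forall>m\<in>carrier M.
        act (p \<otimes>\<^bsub>P\<^esub> p') m = act p (act p' m) \<ominus>\<^bsub>M\<^esub> act p' (act p m)) \<and>
     (\<forall>p\<in>carrier P. \<forall>m\<in>carrier M. \<forall>m'\<in>carrier M.
        act p (m \<otimes>\<^bsub>M\<^esub> m') = act p m \<otimes>\<^bsub>M\<^esub> m' \<oplus>\<^bsub>M\<^esub> m \<otimes>\<^bsub>M\<^esub> act p m')"


section \<open>Coproducts\<close>

text \<open>
  The coproduct \<open>A + B\<close> is given by generators and relations: Lie algebra terms over the elements
  of \<open>A\<close> and \<open>B\<close>, modulo the least congruence that contains the Lie algebra axioms and makes
  the inclusions of generators into morphisms.
\<close>

datatype ('r, 'a, 'b) lie_term =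
    GenL 'a
  | GenR 'b
  | Zero
  | Add "('r, 'a, 'b) lie_term" "('r, 'a, 'b) lie_term"
  | Neg "('r, 'a, 'b) lie_term"
  | Scal 'r "('r, 'a, 'b) lie_term"
  | Bracket "('r, 'a, 'b) lie_term" "('r, 'a, 'b) lie_term"

inductive_set lie_terms ::
    "('r, 'x) ring_scheme \<Rightarrow> ('r, 'a) module \<Rightarrow> ('r, 'b) module \<Rightarrow> ('r, 'a, 'b) lie_term set"
  for R :: "('r, 'x) ring_scheme" and A :: "('r, 'a) module" and B :: "('r, 'b) module" where
  GenL: "a \<in> carrier A \<Longrightarrow> GenL a \<in> lie_terms R A B"
| GenR: "b \<in> carrier B \<Longrightarrow> GenR b \<in> lie_terms R A B"
| Zero: "Zero \<in> lie_terms R A B"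
| Add: "\<lbrakk>s \<in> lie_terms R A B; t \<in> lie_terms R A B\<rbrakk> \<Longrightarrow> Add s t \<in> lie_terms R A B"
| Neg: "s \<in> lie_terms R A B \<Longrightarrow> Neg s \<in> lie_terms R A B"
| Scal: "\<lbrakk>r \<in> carrier R; s \<in> lie_terms R A B\<rbrakk> \<Longrightarrow> Scal r s \<in> lie_terms R A B"
| Bracket: "\<lbrakk>s \<in> lie_terms R A B; t \<in> lie_terms R A B\<rbrakk> \<Longrightarrow> Bracket s t \<in> lie_terms R A B"

inductive lie_cong ::
    "('r, 'x) ring_scheme \<Rightarrow> ('r, 'a) module \<Rightarrow> ('r, 'b) module \<Rightarrow>
     ('r, 'a, 'b) lie_term \<Rightarrow> ('r, 'a, 'b) lie_term \<Rightarrow> bool"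
  for R :: "('r, 'x) ring_scheme" and A :: "('r, 'a) module" and B :: "('r, 'b) module" where
  refl: "s \<in> lie_terms R A B \<Longrightarrow> lie_cong R A B s s"
| sym: "lie_cong R A B s t \<Longrightarrow> lie_cong R A B t s"
| trans: "\<lbrakk>lie_cong R A B s t; lie_cong R A B t u\<rbrakk> \<Longrightarrow> lie_cong R A B s u"
| cong_Add: "\<lbrakk>lie_cong R A B s s'; lie_cong R A B t t'\<rbrakk> \<Longrightarrow> lie_cong R A B (Add s t) (Add s' t')"
| cong_Neg: "lie_cong R A B s s' \<Longrightarrow> lie_cong R A B (Neg s) (Neg s')"
| cong_Scal: "\<lbrakk>r \<in> carrier R; lie_cong R A B s s'\<rbrakk> \<Longrightarrow> lie_cong R A B (Scal r s) (Scal r s')"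
| cong_Bracket: "\<lbrakk>lie_cong R A B s s'; lie_cong R A B t t'\<rbrakk> \<Longrightarrow>
    lie_cong R A B (Bracket s t) (Bracket s' t')"
| add_assoc: "\<lbrakk>s \<in> lie_terms R A B; t \<in> lie_terms R A B; u \<in> lie_terms R A B\<rbrakk> \<Longrightarrow>
    lie_cong R A B (Add (Add s t) u) (Add s (Add t u))"
| add_comm: "\<lbrakk>s \<in> lie_terms R A B; t \<in> lie_terms R A B\<rbrakk> \<Longrightarrow> lie_cong R A B (Add s t) (Add t s)"
| add_zero: "s \<in> lie_terms R A B \<Longrightarrow> lie_cong R A B (Add Zero s) s"
| add_neg: "s \<in> lie_terms R A B \<Longrightarrow> lie_cong R A B (Add (Neg s) s) Zero"
| scal_add_left: "\<lbrakk>r \<in> carrier R; r' \<in> carrier R; s \<in> lie_terms R A B\<rbrakk> \<Longrightarrow>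
    lie_cong R A B (Scal (r \<oplus>\<^bsub>R\<^esub> r') s) (Add (Scal r s) (Scal r' s))"
| scal_add_right: "\<lbrakk>r \<in> carrier R; s \<in> lie_terms R A B; t \<in> lie_terms R A B\<rbrakk> \<Longrightarrow>
    lie_cong R A B (Scal r (Add s t)) (Add (Scal r s) (Scal r t))"
| scal_mult: "\<lbrakk>r \<in> carrier R; r' \<in> carrier R; s \<in> lie_terms R A B\<rbrakk> \<Longrightarrow>
    lie_cong R A B (Scal (r \<otimes>\<^bsub>R\<^esub> r') s) (Scal r (Scal r' s))"
| scal_one: "s \<in> lie_terms R A B \<Longrightarrow> lie_cong R A B (Scal \<one>\<^bsub>R\<^esub> s) s"
| bracket_add_left: "\<lbrakk>s \<in> lie_terms R A B; t \<in> lie_terms R A B; u \<in> lie_terms R A B\<rbrakk> \<Longrightarrow>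
    lie_cong R A B (Bracket (Add s t) u) (Add (Bracket s u) (Bracket t u))"
| bracket_add_right: "\<lbrakk>s \<in> lie_terms R A B; t \<in> lie_terms R A B; u \<in> lie_terms R A B\<rbrakk> \<Longrightarrow>
    lie_cong R A B (Bracket s (Add t u)) (Add (Bracket s t) (Bracket s u))"
| bracket_scal_left: "\<lbrakk>r \<in> carrier R; s \<in> lie_terms R A B; t \<in> lie_terms R A B\<rbrakk> \<Longrightarrow>
    lie_cong R A B (Bracket (Scal r s) t) (Scal r (Bracket s t))"
| bracket_scal_right: "\<lbrakk>r \<in> carrier R; s \<in> lie_terms R A B; t \<in> lie_terms R A B\<rbrakk> \<Longrightarrow>
    lie_cong R A B (Bracket s (Scal r t)) (Scal r (Bracket s t))"
| bracket_self: "s \<in> lie_terms R A B \<Longrightarrow> lie_cong R A B (Bracket s s) Zero"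
| jacobi: "\<lbrakk>s \<in> lie_terms R A B; t \<in> lie_terms R A B; u \<in> lie_terms R A B\<rbrakk> \<Longrightarrow>
    lie_cong R A B
      (Add (Add (Bracket s (Bracket t u)) (Bracket t (Bracket u s))) (Bracket u (Bracket s t)))
      Zero"
| genL_add: "\<lbrakk>a \<in> carrier A; a' \<in> carrier A\<rbrakk> \<Longrightarrow>
    lie_cong R A B (GenL (a \<oplus>\<^bsub>A\<^esub> a')) (Add (GenL a) (GenL a'))"
| genL_scal: "\<lbrakk>r \<in> carrier R; a \<in> carrier A\<rbrakk> \<Longrightarrow>
    lie_cong R A B (GenL (r \<odot>\<^bsub>A\<^esub> a)) (Scal r (GenL a))"
| genL_bracket: "\<lbrakk>a \<in> carrier A; a' \<in> carrier A\<rbrakk> \<Longrightarrow>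
    lie_cong R A B (GenL (a \<otimes>\<^bsub>A\<^esub> a')) (Bracket (GenL a) (GenL a'))"
| genR_add: "\<lbrakk>b \<in> carrier B; b' \<in> carrier B\<rbrakk> \<Longrightarrow>
    lie_cong R A B (GenR (b \<oplus>\<^bsub>B\<^esub> b')) (Add (GenR b) (GenR b'))"
| genR_scal: "\<lbrakk>r \<in> carrier R; b \<in> carrier B\<rbrakk> \<Longrightarrow>
    lie_cong R A B (GenR (r \<odot>\<^bsub>B\<^esub> b)) (Scal r (GenR b))"
| genR_bracket: "\<lbrakk>b \<in> carrier B; b' \<in> carrier B\<rbrakk> \<Longrightarrow>
    lie_cong R A B (GenR (b \<otimes>\<^bsub>B\<^esub> b')) (Bracket (GenR b) (GenR b'))"

type_synonym ('r, 'a, 'b) coprod_elem = "('r, 'a, 'b) lie_term set"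

definition lie_class ::
    "('r, 'x) ring_scheme \<Rightarrow> ('r, 'a) module \<Rightarrow> ('r, 'b) module \<Rightarrow>
     ('r, 'a, 'b) lie_term \<Rightarrow> ('r, 'a, 'b) coprod_elem" where
  "lie_class R A B s = {t. lie_cong R A B s t}"

definition coprod ::
    "('r, 'x) ring_scheme \<Rightarrow> ('r, 'a) module \<Rightarrow> ('r, 'b) module \<Rightarrow>
     ('r, ('r, 'a, 'b) coprod_elem) module" where
  "coprod R A B = \<lparr>
     carrier = lie_class R A B ` lie_terms R A B,
     mult = (\<lambda>X Y. \<Union>s\<in>X. \<Union>t\<in>Y. lie_class R A B (Bracket s t)),
     one = undefined,
     zero = lie_class R A B Zero,
     add = (\<lambda>X Y. \<Union>s\<in>X. \<Union>t\<in>Y. lie_class R A B (Add s t)),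
     smult = (\<lambda>r X. \<Union>s\<in>X. lie_class R A B (Scal r s))\<rparr>"

definition inl ::
    "('r, 'x) ring_scheme \<Rightarrow> ('r, 'a) module \<Rightarrow> ('r, 'b) module \<Rightarrow>
     'a \<Rightarrow> ('r, 'a, 'b) coprod_elem" where
  "inl R A B = (\<lambda>a\<in>carrier A. lie_class R A B (GenL a))"

definition inr ::
    "('r, 'x) ring_scheme \<Rightarrow> ('r, 'a) module \<Rightarrow> ('r, 'b) module \<Rightarrow>
     'b \<Rightarrow> ('r, 'a, 'b) coprod_elem" where
  "inr R A B = (\<lambda>b\<in>carrier B. lie_class R A B (GenR b))"

lemma lie_cong_terms:
  assumes "lie_algebra R A" "lie_algebra R B" "lie_cong R A B s t"
  shows "s \<in> lie_terms R A B \<and> t \<in> lie_terms R A B"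
proof -
  interpret A: lie_algebra R A by fact
  interpret B: lie_algebra R B by fact
  from assms(3) show ?thesis
    by induction (auto intro: lie_terms.intros)
qed

lemma lie_class_eq_iff:
  assumes "t \<in> lie_terms R A B"
  shows "lie_class R A B s = lie_class R A B t \<longleftrightarrow> lie_cong R A B s t"
proof
  assume "lie_class R A B s = lie_class R A B t"
  then show "lie_cong R A B s t"
    using lie_cong.refl[OF assms] by (auto simp: lie_class_def)
next
  assume "lie_cong R A B s t"
  then show "lie_class R A B s = lie_class R A B t"
    unfolding lie_class_def by (blast intro: lie_cong.trans lie_cong.sym)
qed

lemma lie_class_self: "s \<in> lie_terms R A B \<Longrightarrow> s \<in> lie_class R A B s"
  by (simp add: lie_class_def lie_cong.refl)

lemma lie_class_UN:
  assumes "s \<in> lie_terms R A B"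
    and "\<And>s'. lie_cong R A B s s' \<Longrightarrow> lie_cong R A B (F s) (F s')"
  shows "(\<Union>s'\<in>lie_class R A B s. lie_class R A B (F s')) = lie_class R A B (F s)"
proof -
  have "lie_class R A B (F s') = lie_class R A B (F s)" if "s' \<in> lie_class R A B s" for s'
    using assms(2)[of s'] that unfolding lie_class_def
    by (blast intro: lie_cong.trans lie_cong.sym)
  then show ?thesis using lie_class_self[OF assms(1)] by blast
qed

lemma coprod_zero: "\<zero>\<^bsub>coprod R A B\<^esub> = lie_class R A B Zero"
  by (simp add: coprod_def)

lemma coprod_carrier: "carrier (coprod R A B) = lie_class R A B ` lie_terms R A B"
  by (simp add: coprod_def)

lemma coprod_smult:
  assumes "r \<in> carrier R" "s \<in> lie_terms R A B"
  shows "r \<odot>\<^bsub>coprod R A B\<^esub> lie_class R A B s = lie_class R A B (Scal r s)"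
  using assms by (simp add: coprod_def lie_class_UN lie_cong.cong_Scal)

lemma coprod_add:
  assumes "s \<in> lie_terms R A B" "t \<in> lie_terms R A B"
  shows "lie_class R A B s \<oplus>\<^bsub>coprod R A B\<^esub> lie_class R A B t = lie_class R A B (Add s t)"
proof -
  have "(\<Union>t'\<in>lie_class R A B t. lie_class R A B (Add s' t')) = lie_class R A B (Add s' t)"
    if "s' \<in> lie_class R A B s" for s'
    using that assms
    by (intro lie_class_UN lie_cong.cong_Add) 
      (auto simp: lie_class_def intro: lie_cong.refl lie_cong.trans lie_cong.sym)
  then have "lie_class R A B s \<oplus>\<^bsub>coprod R A B\<^esub> lie_class R A B t =
      (\<Union>s'\<in>lie_class R A B s. lie_class R A B (Add s' t))"
    by (simp add: coprod_def)
  also have "\<dots> = lie_class R A B (Add s t)"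
    using assms by (intro lie_class_UN) (auto intro: lie_cong.cong_Add lie_cong.refl)
  finally show ?thesis .
qed

lemma coprod_bracket:
  assumes "s \<in> lie_terms R A B" "t \<in> lie_terms R A B"
  shows "lie_class R A B s \<otimes>\<^bsub>coprod R A B\<^esub> lie_class R A B t = lie_class R A B (Bracket s t)"
proof -
  have "(\<Union>t'\<in>lie_class R A B t. lie_class R A B (Bracket s' t')) = lie_class R A B (Bracket s' t)"
    if "s' \<in> lie_class R A B s" for s'
    using that assms
    by (intro lie_class_UN lie_cong.cong_Bracket) 
      (auto simp: lie_class_def intro: lie_cong.refl lie_cong.trans lie_cong.sym)
  then have "lie_class R A B s \<otimes>\<^bsub>coprod R A B\<^esub> lie_class R A B t =
      (\<Union>s'\<in>lie_class R A B s. lie_class R A B (Bracket s' t))"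
    by (simp add: coprod_def)
  also have "\<dots> = lie_class R A B (Bracket s t)"
    using assms by (intro lie_class_UN) (auto intro: lie_cong.cong_Bracket lie_cong.refl)
  finally show ?thesis .
qed

lemmas coprod_ops = coprod_zero coprod_smult coprod_add coprod_bracket

lemma coprod_lie_algebra:
  assumes "lie_algebra R A" "lie_algebra R B"
  shows "lie_algebra R (coprod R A B)"
proof -
  interpret A: lie_algebra R A by fact
  interpret B: lie_algebra R B by fact
  note [simp] = lie_terms.intros lie_class_eq_iff coprod_ops
  show ?thesis
  proof (intro lie_algebra.intro lie_algebra_axioms.intro moduleI abelian_groupI)
    show "cring R" by (rule A.R.is_cring)
    show "\<exists>y\<in>carrier (coprod R A B). y \<oplus>\<^bsub>coprod R A B\<^esub> x = \<zero>\<^bsub>coprod R A B\<^esub>"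
      if "x \<in> carrier (coprod R A B)" for x
    proof -
      from that obtain s where s: "s \<in> lie_terms R A B" "x = lie_class R A B s"
        by (auto simp: coprod_carrier)
      show ?thesis
        by (rule bexI[of _ "lie_class R A B (Neg s)"])
          (use s in \<open>simp_all add: coprod_carrier lie_cong.intros\<close>)
    qed
  qed (auto simp: coprod_carrier intro: lie_cong.add_assoc lie_cong.add_comm lie_cong.add_zero
      lie_cong.scal_add_left lie_cong.scal_add_right lie_cong.scal_mult lie_cong.scal_one
      lie_cong.bracket_add_left lie_cong.bracket_add_right lie_cong.bracket_scal_left
      lie_cong.bracket_scal_right lie_cong.bracket_self lie_cong.jacobi
      del: equalityI)
qed

lemma lie_homD:
  assumes "h \<in> lie_hom R A B"
  shows "x \<in> carrier A \<Longrightarrow> h x \<in> carrier B"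
    and "x \<notin> carrier A \<Longrightarrow> h x = undefined"
    and "\<lbrakk>x \<in> carrier A; y \<in> carrier A\<rbrakk> \<Longrightarrow> h (x \<oplus>\<^bsub>A\<^esub> y) = h x \<oplus>\<^bsub>B\<^esub> h y"
    and "\<lbrakk>r \<in> carrier R; x \<in> carrier A\<rbrakk> \<Longrightarrow> h (r \<odot>\<^bsub>A\<^esub> x) = r \<odot>\<^bsub>B\<^esub> h x"
    and "\<lbrakk>x \<in> carrier A; y \<in> carrier A\<rbrakk> \<Longrightarrow> h (x \<otimes>\<^bsub>A\<^esub> y) = h x \<otimes>\<^bsub>B\<^esub> h y"
  using assms unfolding lie_hom_def
  by (blast dest: PiE_mem PiE_arb)+

lemma lie_hom_zero:
  assumes "lie_algebra R A" "lie_algebra R B" "h \<in> lie_hom R A B"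
  shows "h \<zero>\<^bsub>A\<^esub> = \<zero>\<^bsub>B\<^esub>"
proof -
  interpret A: lie_algebra R A by fact
  interpret B: lie_algebra R B by fact
  have "h \<zero>\<^bsub>A\<^esub> = h (\<zero>\<^bsub>R\<^esub> \<odot>\<^bsub>A\<^esub> \<zero>\<^bsub>A\<^esub>)" by simp
  also have "\<dots> = \<zero>\<^bsub>R\<^esub> \<odot>\<^bsub>B\<^esub> h \<zero>\<^bsub>A\<^esub>"
    using assms(3) by (intro lie_homD(4)) auto
  also have "\<dots> = \<zero>\<^bsub>B\<^esub>" using lie_homD(1)[OF assms(3)] by simp
  finally show ?thesis .
qed

lemma inl_hom:
  assumes "lie_algebra R A" "lie_algebra R B"
  shows "inl R A B \<in> lie_hom R A (coprod R A B)"
proof -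
  interpret A: lie_algebra R A by fact
  show ?thesis
    by (auto simp: lie_hom_def inl_def coprod_carrier coprod_ops lie_terms.intros
        lie_class_eq_iff intro: lie_cong.intros)
qed

lemma inr_hom:
  assumes "lie_algebra R A" "lie_algebra R B"
  shows "inr R A B \<in> lie_hom R B (coprod R A B)"
proof -
  interpret B: lie_algebra R B by fact
  show ?thesis
    by (auto simp: lie_hom_def inr_def coprod_carrier coprod_ops lie_terms.intros
        lie_class_eq_iff intro: lie_cong.intros)
qed

primrec lie_eval ::
    "('r, 'c) module \<Rightarrow> ('a \<Rightarrow> 'c) \<Rightarrow> ('b \<Rightarrow> 'c) \<Rightarrow> ('r, 'a, 'b) lie_term \<Rightarrow> 'c" where
  "lie_eval C f g (GenL a) = f a"
| "lie_eval C f g (GenR b) = g b"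
| "lie_eval C f g Zero = \<zero>\<^bsub>C\<^esub>"
| "lie_eval C f g (Add s t) = lie_eval C f g s \<oplus>\<^bsub>C\<^esub> lie_eval C f g t"
| "lie_eval C f g (Neg s) = \<ominus>\<^bsub>C\<^esub> lie_eval C f g s"
| "lie_eval C f g (Scal r s) = r \<odot>\<^bsub>C\<^esub> lie_eval C f g s"
| "lie_eval C f g (Bracket s t) = lie_eval C f g s \<otimes>\<^bsub>C\<^esub> lie_eval C f g t"

lemma lie_eval_closed:
  assumes "lie_algebra R C" "f \<in> lie_hom R A C" "g \<in> lie_hom R B C" "s \<in> lie_terms R A B"
  shows "lie_eval C f g s \<in> carrier C"
proof -
  interpret C: lie_algebra R C by fact
  from assms(4) show ?thesis
    by induction (auto simp: lie_homD[OF assms(2)] lie_homD[OF assms(3)])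
qed

lemma lie_eval_cong:
  assumes "lie_algebra R A" "lie_algebra R B" "lie_algebra R C"
    and f: "f \<in> lie_hom R A C" and g: "g \<in> lie_hom R B C" and "lie_cong R A B s t"
  shows "lie_eval C f g s = lie_eval C f g t"
proof -
  interpret C: lie_algebra R C by fact
  note [simp] = lie_eval_closed[OF assms(3) f g] lie_homD[OF f] lie_homD[OF g]
  from assms(6) show ?thesis
  proof induction
    case (add_comm s t)
    then show ?case by (simp add: C.M.a_comm)
  next
    case (jacobi s t u)
    then show ?case by (simp add: C.jacobi)
  qed (simp_all add: C.M.a_assoc C.M.l_neg C.smult_l_distr C.smult_r_distr C.smult_assoc1
      C.bracket_add_left C.bracket_add_right C.bracket_smult_left C.bracket_smult_right
      C.bracket_self)
qed

text \<open>The universal property of the coproduct.\<close>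

lemma coprod_universal:
  assumes A: "lie_algebra R A" and B: "lie_algebra R B" and C: "lie_algebra R C"
    and f: "f \<in> lie_hom R A C" and g: "g \<in> lie_hom R B C"
  shows "\<exists>!h. h \<in> lie_hom R (coprod R A B) C \<and>
    compose (carrier A) h (inl R A B) = f \<and> compose (carrier B) h (inr R A B) = g"
proof (rule ex1I)
  interpret C: lie_algebra R C by fact
  interpret S: lie_algebra R "coprod R A B" by (rule coprod_lie_algebra[OF A B])
  let ?h = "\<lambda>X\<in>carrier (coprod R A B). lie_eval C f g (SOME s. s \<in> X)"
  have h: "?h (lie_class R A B s) = lie_eval C f g s" if "s \<in> lie_terms R A B" for s
  proof -
    have "(SOME t. t \<in> lie_class R A B s) \<in> lie_class R A B s"
      using lie_class_self[OF that] by (rule someI)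
    then have "lie_eval C f g (SOME t. t \<in> lie_class R A B s) = lie_eval C f g s"
      using lie_eval_cong[OF A B C f g] by (simp add: lie_class_def)
    then show ?thesis using that by (simp add: coprod_carrier)
  qed
  have clos: "?h (lie_class R A B s) \<in> carrier C" if "s \<in> lie_terms R A B" for s
    using h[OF that] lie_eval_closed[OF C f g that] by simp
  have "?h \<in> lie_hom R (coprod R A B) C"
    unfolding lie_hom_def
  proof (intro CollectI conjI ballI PiE_I)
    fix X assume "X \<in> carrier (coprod R A B)"
    then show "?h X \<in> carrier C" using clos by (auto simp only: coprod_carrier)
  next
    fix X Y assume "X \<in> carrier (coprod R A B)" "Y \<in> carrier (coprod R A B)"
    then obtain s t where *: "s \<in> lie_terms R A B" "t \<in> lie_terms R A B"
      "X = lie_class R A B s" "Y = lie_class R A B t" by (auto simp only: coprod_carrier)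
    show "?h (X \<oplus>\<^bsub>coprod R A B\<^esub> Y) = ?h X \<oplus>\<^bsub>C\<^esub> ?h Y"
      unfolding * coprod_add[OF *(1,2)] h[OF *(1)] h[OF *(2)] h[OF lie_terms.Add[OF *(1,2)]]
      by simp
    show "?h (X \<otimes>\<^bsub>coprod R A B\<^esub> Y) = ?h X \<otimes>\<^bsub>C\<^esub> ?h Y"
      unfolding * coprod_bracket[OF *(1,2)] h[OF *(1)] h[OF *(2)] h[OF lie_terms.Bracket[OF *(1,2)]]
      by simp
  next
    fix r X assume r: "r \<in> carrier R" and "X \<in> carrier (coprod R A B)"
    then obtain s where *: "s \<in> lie_terms R A B" "X = lie_class R A B s"
      by (auto simp only: coprod_carrier)
    show "?h (r \<odot>\<^bsub>coprod R A B\<^esub> X) = r \<odot>\<^bsub>C\<^esub> ?h X"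
      unfolding * coprod_smult[OF r *(1)] h[OF *(1)] h[OF lie_terms.Scal[OF r *(1)]] by simp
  qed simp
  moreover have "compose (carrier A) ?h (inl R A B) = f"
  proof
    fix x show "compose (carrier A) ?h (inl R A B) x = f x"
      using h[OF lie_terms.GenL[of x]] lie_homD(2)[OF f, of x]
      by (cases "x \<in> carrier A") (simp_all add: compose_def inl_def split: if_splits)
  qed
  moreover have "compose (carrier B) ?h (inr R A B) = g"
  proof
    fix x show "compose (carrier B) ?h (inr R A B) x = g x"
      using h[OF lie_terms.GenR[of x]] lie_homD(2)[OF g, of x]
      by (cases "x \<in> carrier B") (simp_all add: compose_def inr_def split: if_splits)
  qed
  ultimately show "?h \<in> lie_hom R (coprod R A B) C \<and>
    compose (carrier A) ?h (inl R A B) = f \<and> compose (carrier B) ?h (inr R A B) = g" by blast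
  fix k assume k: "k \<in> lie_hom R (coprod R A B) C \<and>
    compose (carrier A) k (inl R A B) = f \<and> compose (carrier B) k (inr R A B) = g"
  then have kh: "k \<in> lie_hom R (coprod R A B) C" by blast
  have kL: "k (lie_class R A B (GenL a)) = f a" if "a \<in> carrier A" for a
    using k that by (metis compose_eq inl_def restrict_apply)
  have kR: "k (lie_class R A B (GenR b)) = g b" if "b \<in> carrier B" for b
    using k that by (metis compose_eq inr_def restrict_apply)
  have ke: "k (lie_class R A B s) = lie_eval C f g s" if "s \<in> lie_terms R A B" for s
    using that
  proof induction
    case Zero
    then show ?case
      using lie_hom_zero[OF S.lie_algebra_axioms C kh] by (simp add: coprod_zero)
  next
    case (Add s t)
    then show ?case
      using lie_homD(3)[OF kh, of "lie_class R A B s" "lie_class R A B t"]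
      by (simp add: coprod_add coprod_carrier)
  next
    case (Neg s)
    let ?c = "lie_class R A B"
    have c: "?c s \<in> carrier (coprod R A B)" "?c (Neg s) \<in> carrier (coprod R A B)"
      using Neg by (auto simp: coprod_carrier lie_terms.Neg)
    have "?c (Neg s) \<oplus>\<^bsub>coprod R A B\<^esub> ?c s = \<zero>\<^bsub>coprod R A B\<^esub>"
      using Neg by (simp add: coprod_ops lie_terms.intros lie_class_eq_iff lie_cong.add_neg)
    then have "k (?c (Neg s)) \<oplus>\<^bsub>C\<^esub> k (?c s) = \<zero>\<^bsub>C\<^esub>"
      using lie_homD(3)[OF kh c(2,1)] lie_hom_zero[OF S.lie_algebra_axioms C kh] by simp
    then have "k (?c (Neg s)) = \<ominus>\<^bsub>C\<^esub> k (?c s)"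
      using lie_homD(1)[OF kh c(1)] lie_homD(1)[OF kh c(2)] by (simp add: C.M.minus_equality)
    then show ?case using Neg by simp
  next
    case (Scal r s)
    then show ?case
      using lie_homD(4)[OF kh, of r "lie_class R A B s"] by (simp add: coprod_smult coprod_carrier)
  next
    case (Bracket s t)
    then show ?case
      using lie_homD(5)[OF kh, of "lie_class R A B s" "lie_class R A B t"]
      by (simp add: coprod_bracket coprod_carrier)
  qed (simp_all add: kL kR)
  show "k = ?h"
  proof
    fix X show "k X = ?h X"
    proof (cases "X \<in> carrier (coprod R A B)")
      case True
      then obtain s where *: "s \<in> lie_terms R A B" "X = lie_class R A B s"
        by (auto simp only: coprod_carrier)
      show ?thesis unfolding * h[OF *(1)] ke[OF *(1)] ..
    next
      case False
      then show ?thesis using lie_homD(2)[OF kh] by simp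
    qed
  qed
qed

definition copair ::
    "('r, 'x) ring_scheme \<Rightarrow> ('r, 'a) module \<Rightarrow> ('r, 'b) module \<Rightarrow> ('r, 'c) module \<Rightarrow>
     ('a \<Rightarrow> 'c) \<Rightarrow> ('b \<Rightarrow> 'c) \<Rightarrow> ('r, 'a, 'b) coprod_elem \<Rightarrow> 'c" where
  "copair R A B C f g = (THE h. h \<in> lie_hom R (coprod R A B) C \<and>
     compose (carrier A) h (inl R A B) = f \<and> compose (carrier B) h (inr R A B) = g)"

definition coprod_map ::
    "('r, 'x) ring_scheme \<Rightarrow> ('r, 'a) module \<Rightarrow> ('r, 'b) module \<Rightarrow>
     ('r, 'c) module \<Rightarrow> ('r, 'd) module \<Rightarrow> ('a \<Rightarrow> 'c) \<Rightarrow> ('b \<Rightarrow> 'd) \<Rightarrow>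
     ('r, 'a, 'b) coprod_elem \<Rightarrow> ('r, 'c, 'd) coprod_elem" where
  "coprod_map R A B C D f g = copair R A B (coprod R C D)
     (compose (carrier A) (inl R C D) f) (compose (carrier B) (inr R C D) g)"

text \<open>The identification of \<open>B + A\<close> with \<open>A + B\<close>.\<close>

definition coprod_swap ::
    "('r, 'x) ring_scheme \<Rightarrow> ('r, 'b) module \<Rightarrow> ('r, 'a) module \<Rightarrow>
     ('r, 'b, 'a) coprod_elem \<Rightarrow> ('r, 'a, 'b) coprod_elem" where
  "coprod_swap R B A = copair R B A (coprod R A B) (inr R A B) (inl R A B)"


section \<open>The object \<open>P \<flat> M\<close> and internal actions\<close>

definition lie_id :: "('r, 'a) module \<Rightarrow> 'a \<Rightarrow> 'a" where
  "lie_id A = (\<lambda>x\<in>carrier A. x)"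

definition lie_zero :: "('r, 'a) module \<Rightarrow> ('r, 'b) module \<Rightarrow> 'a \<Rightarrow> 'b" where
  "lie_zero A B = (\<lambda>x\<in>carrier A. \<zero>\<^bsub>B\<^esub>)"

definition flat ::
    "('r, 'x) ring_scheme \<Rightarrow> ('r, 'p) module \<Rightarrow> ('r, 'm) module \<Rightarrow>
     ('r, ('r, 'p, 'm) coprod_elem) module" where
  "flat R P M = (coprod R P M)\<lparr>carrier :=
     {x \<in> carrier (coprod R P M). copair R P M P (lie_id P) (lie_zero M P) x = \<zero>\<^bsub>P\<^esub>}\<rparr>"

definition flat_incl ::
    "('r, 'x) ring_scheme \<Rightarrow> ('r, 'p) module \<Rightarrow> ('r, 'm) module \<Rightarrow>
     ('r, 'p, 'm) coprod_elem \<Rightarrow> ('r, 'p, 'm) coprod_elem" where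
  "flat_incl R P M = (\<lambda>x\<in>carrier (flat R P M). x)"

definition internal_action ::
    "('r, 'x) ring_scheme \<Rightarrow> ('r, 'p) module \<Rightarrow> ('r, 'm) module \<Rightarrow> ('p \<Rightarrow> 'm \<Rightarrow> 'm) \<Rightarrow>
     ('r, 'p, 'm) coprod_elem \<Rightarrow> 'm" where
  "internal_action R P M act = (THE \<xi>. \<xi> \<in> lie_hom R (flat R P M) M \<and>
     (\<forall>m\<in>carrier M. \<xi> (inr R P M m) = m) \<and>
     (\<forall>p\<in>carrier P. \<forall>x\<in>carrier (flat R P M).
        \<xi> (inl R P M p \<otimes>\<^bsub>coprod R P M\<^esub> x) = act p (\<xi> x)))"


section \<open>Quotients and the Peiffer product\<close>

definition lie_ideal ::
    "('r, 'x) ring_scheme \<Rightarrow> ('r, 'a) module \<Rightarrow> 'a set \<Rightarrow> bool" where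
  "lie_ideal R L I \<longleftrightarrow> submodule I R L \<and>
     (\<forall>x\<in>carrier L. \<forall>y\<in>I. x \<otimes>\<^bsub>L\<^esub> y \<in> I \<and> y \<otimes>\<^bsub>L\<^esub> x \<in> I)"

definition gen_lie_ideal ::
    "('r, 'x) ring_scheme \<Rightarrow> ('r, 'a) module \<Rightarrow> 'a set \<Rightarrow> 'a set" where
  "gen_lie_ideal R L S = \<Inter>{I. lie_ideal R L I \<and> S \<subseteq> I}"

definition lie_quot :: "('r, 'a) module \<Rightarrow> 'a set \<Rightarrow> ('r, 'a set) module" where
  "lie_quot L I = \<lparr>
     carrier = a_rcosets\<^bsub>L\<^esub> I,
     mult = rcoset_mult L I,
     one = undefined,
     zero = I,
     add = set_add L,
     smult = (\<lambda>r X. \<Union>x\<in>X. I +>\<^bsub>L\<^esub> (r \<odot>\<^bsub>L\<^esub> x))\<rparr>"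

definition quot_map :: "('r, 'a) module \<Rightarrow> 'a set \<Rightarrow> 'a \<Rightarrow> 'a set" where
  "quot_map L I = (\<lambda>x\<in>carrier L. I +>\<^bsub>L\<^esub> x)"

text \<open>\<open>actNM n m\<close> is \<open>\<^sup>nm\<close> and \<open>actMN m n\<close> is \<open>\<^sup>mn\<close>.\<close>

definition peiffer_ideal ::
    "('r, 'x) ring_scheme \<Rightarrow> ('r, 'm) module \<Rightarrow> ('r, 'n) module \<Rightarrow>
     ('m \<Rightarrow> 'n \<Rightarrow> 'n) \<Rightarrow> ('n \<Rightarrow> 'm \<Rightarrow> 'm) \<Rightarrow> ('r, 'm, 'n) coprod_elem set" where
  "peiffer_ideal R M N actMN actNM = gen_lie_ideal R (coprod R M N)
     ({inl R M N (actNM n m) \<ominus>\<^bsub>coprod R M N\<^esub> inr R M N n \<otimes>\<^bsub>coprod R M N\<^esub> inl R M N m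
        | m n. m \<in> carrier M \<and> n \<in> carrier N} \<union>
      {inr R M N (actMN m n) \<ominus>\<^bsub>coprod R M N\<^esub> inl R M N m \<otimes>\<^bsub>coprod R M N\<^esub> inr R M N n
        | m n. m \<in> carrier M \<and> n \<in> carrier N})"

definition peiffer_product ::
    "('r, 'x) ring_scheme \<Rightarrow> ('r, 'm) module \<Rightarrow> ('r, 'n) module \<Rightarrow>
     ('m \<Rightarrow> 'n \<Rightarrow> 'n) \<Rightarrow> ('n \<Rightarrow> 'm \<Rightarrow> 'm) \<Rightarrow> ('r, ('r, 'm, 'n) coprod_elem set) module" where
  "peiffer_product R M N actMN actNM =
     lie_quot (coprod R M N) (peiffer_ideal R M N actMN actNM)"

definition peiffer_quot_map ::
    "('r, 'x) ring_scheme \<Rightarrow> ('r, 'm) module \<Rightarrow> ('r, 'n) module \<Rightarrow>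
     ('m \<Rightarrow> 'n \<Rightarrow> 'n) \<Rightarrow> ('n \<Rightarrow> 'm \<Rightarrow> 'm) \<Rightarrow>
     ('r, 'm, 'n) coprod_elem \<Rightarrow> ('r, 'm, 'n) coprod_elem set" where
  "peiffer_quot_map R M N actMN actNM =
     quot_map (coprod R M N) (peiffer_ideal R M N actMN actNM)"


section \<open>Coequalizers\<close>

text \<open>
  The type argument is the type of the elements of the test objects \<open>C\<close>. A theorem about
  \<open>is_lie_coequalizer TYPE('c)\<close> with a free type variable \<open>'c\<close> covers all test objects.
\<close>

definition is_lie_coequalizer ::
    "'c itself \<Rightarrow> ('r, 'x) ring_scheme \<Rightarrow> ('r, 'a) module \<Rightarrow> ('r, 'b) module \<Rightarrow>
     ('a \<Rightarrow> 'b) \<Rightarrow> ('a \<Rightarrow> 'b) \<Rightarrow> ('r, 'q) module \<Rightarrow> ('b \<Rightarrow> 'q) \<Rightarrow> bool" where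
  "is_lie_coequalizer _ R A B f g Q q \<longleftrightarrow>
     lie_algebra R A \<and> lie_algebra R B \<and> f \<in> lie_hom R A B \<and> g \<in> lie_hom R A B \<and>
     lie_algebra R Q \<and> q \<in> lie_hom R B Q \<and>
     compose (carrier A) q f = compose (carrier A) q g \<and>
     (\<forall>(C :: ('r, 'c) module) h. lie_algebra R C \<and> h \<in> lie_hom R B C \<and>
        compose (carrier A) h f = compose (carrier A) h g \<longrightarrow>
        (\<exists>!u. u \<in> lie_hom R Q C \<and> compose (carrier B) u q = h))"

end

theory Submission
  imports Defs
begin

text \<open>
  Let \<open>f : P \<rightarrow> C\<close> and \<open>g : M \<rightarrow> C\<close> be morphisms. Since \<open>P \<flat> M\<close> is generated from \<open>M\<close> by linear
  combinations, brackets and the operations \<open>[p, -]\<close>, the morphism induced by \<open>f\<close> and \<open>g\<close> agrees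
  with \<open>g \<circ> \<xi>\<close> on \<open>P \<flat> M\<close> iff \<open>[f p, g m] = g (\<^sup>pm)\<close> for all \<open>p\<close>, \<open>m\<close>. Applied to both actions,
  this says that a morphism out of \<open>M + N\<close> equalizes the two given morphisms iff it kills the
  generators of \<open>K\<close>, that is, iff it factors through \<open>M \<bowtie> N\<close>. The internal action
  itself is obtained by restricting the canonical morphism \<open>P + M \<rightarrow> P \<ltimes> M\<close> to \<open>P \<flat> M\<close>.
\<close>

section \<open>Lie algebras and their morphisms\<close>

text \<open>Read from left to right, these equations move every subtraction outward and turn
  equations between differences into equations between sums. Identities in the semidirect product
  then reduce to associativity and commutativity.\<close>

lemma (in abelian_group) diff_simps:
  assumes "a \<in> carrier G" "b \<in> carrier G" "c \<in> carrier G"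
  shows "(a \<ominus> b) \<oplus> c = (a \<oplus> c) \<ominus> b"
    and "a \<oplus> (b \<ominus> c) = (a \<oplus> b) \<ominus> c"
    and "(a \<ominus> b) \<ominus> c = a \<ominus> (b \<oplus> c)"
    and "a \<ominus> (b \<ominus> c) = (a \<oplus> c) \<ominus> b"
    and "a \<ominus> b = c \<longleftrightarrow> a = c \<oplus> b"
    and "c = a \<ominus> b \<longleftrightarrow> c \<oplus> b = a"
proof -
  show 1: "(a \<ominus> b) \<oplus> c = (a \<oplus> c) \<ominus> b" "a \<oplus> (b \<ominus> c) = (a \<oplus> b) \<ominus> c"
      "(a \<ominus> b) \<ominus> c = a \<ominus> (b \<oplus> c)" "a \<ominus> (b \<ominus> c) = (a \<oplus> c) \<ominus> b"
    using assms by (simp_all add: minus_eq minus_add a_ac)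
  show 2: "a \<ominus> b = c \<longleftrightarrow> a = c \<oplus> b"
    using assms by (metis add.inv_solve_right minus_eq)
  then show "c = a \<ominus> b \<longleftrightarrow> c \<oplus> b = a" by metis
qed

context lie_algebra
begin

text \<open>With negation seen as a scalar multiplication, whatever respects scalars (brackets,
  morphisms, actions, induction predicates) respects negation as well.\<close>

lemma smult_neg_one: "x \<in> carrier L \<Longrightarrow> (\<ominus> \<one>) \<odot>\<^bsub>L\<^esub> x = \<ominus>\<^bsub>L\<^esub> x"
  by (simp add: smult_l_minus)

lemma smult_diff_right:
  "\<lbrakk>r \<in> carrier R; x \<in> carrier L; y \<in> carrier L\<rbrakk> \<Longrightarrow>
    r \<odot>\<^bsub>L\<^esub> (x \<ominus>\<^bsub>L\<^esub> y) = r \<odot>\<^bsub>L\<^esub> x \<ominus>\<^bsub>L\<^esub> r \<odot>\<^bsub>L\<^esub> y"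
  by (simp add: M.minus_eq smult_r_distr smult_r_minus)

lemma bracket_minus_left:
  "\<lbrakk>x \<in> carrier L; y \<in> carrier L\<rbrakk> \<Longrightarrow> (\<ominus>\<^bsub>L\<^esub> x) \<otimes>\<^bsub>L\<^esub> y = \<ominus>\<^bsub>L\<^esub> (x \<otimes>\<^bsub>L\<^esub> y)"
  using bracket_smult_left[of "\<ominus> \<one>" x y] by (simp add: smult_neg_one)

lemma bracket_minus_right:
  "\<lbrakk>x \<in> carrier L; y \<in> carrier L\<rbrakk> \<Longrightarrow> x \<otimes>\<^bsub>L\<^esub> (\<ominus>\<^bsub>L\<^esub> y) = \<ominus>\<^bsub>L\<^esub> (x \<otimes>\<^bsub>L\<^esub> y)"
  using bracket_smult_right[of "\<ominus> \<one>" x y] by (simp add: smult_neg_one)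

lemma bracket_diff_left:
  "\<lbrakk>x \<in> carrier L; y \<in> carrier L; z \<in> carrier L\<rbrakk> \<Longrightarrow>
    (x \<ominus>\<^bsub>L\<^esub> y) \<otimes>\<^bsub>L\<^esub> z = x \<otimes>\<^bsub>L\<^esub> z \<ominus>\<^bsub>L\<^esub> y \<otimes>\<^bsub>L\<^esub> z"
  by (simp add: M.minus_eq bracket_add_left bracket_minus_left)

lemma bracket_diff_right:
  "\<lbrakk>x \<in> carrier L; y \<in> carrier L; z \<in> carrier L\<rbrakk> \<Longrightarrow>
    x \<otimes>\<^bsub>L\<^esub> (y \<ominus>\<^bsub>L\<^esub> z) = x \<otimes>\<^bsub>L\<^esub> y \<ominus>\<^bsub>L\<^esub> x \<otimes>\<^bsub>L\<^esub> z"
  by (simp add: M.minus_eq bracket_add_right bracket_minus_right)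

lemma bracket_zero_left [simp]: "x \<in> carrier L \<Longrightarrow> \<zero>\<^bsub>L\<^esub> \<otimes>\<^bsub>L\<^esub> x = \<zero>\<^bsub>L\<^esub>"
  using bracket_smult_left[of "\<zero>" "\<zero>\<^bsub>L\<^esub>" x] by simp

lemma bracket_zero_right [simp]: "x \<in> carrier L \<Longrightarrow> x \<otimes>\<^bsub>L\<^esub> \<zero>\<^bsub>L\<^esub> = \<zero>\<^bsub>L\<^esub>"
  using bracket_smult_right[of "\<zero>" x "\<zero>\<^bsub>L\<^esub>"] by simp

text \<open>Polarization: the bracket of x + y with itself vanishes, and so do both diagonal terms
  of its expansion.\<close>

lemma bracket_swap:
  assumes "x \<in> carrier L" "y \<in> carrier L"
  shows "x \<otimes>\<^bsub>L\<^esub> y = \<ominus>\<^bsub>L\<^esub> (y \<otimes>\<^bsub>L\<^esub> x)"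
proof -
  have "(x \<oplus>\<^bsub>L\<^esub> y) \<otimes>\<^bsub>L\<^esub> (x \<oplus>\<^bsub>L\<^esub> y) = \<zero>\<^bsub>L\<^esub>"
    using assms by (intro bracket_self) simp
  then have "x \<otimes>\<^bsub>L\<^esub> y \<oplus>\<^bsub>L\<^esub> y \<otimes>\<^bsub>L\<^esub> x = \<zero>\<^bsub>L\<^esub>"
    using assms bracket_self[of x] bracket_self[of y]
    by (simp add: bracket_add_left bracket_add_right M.a_comm)
  then show ?thesis
    using assms by (simp add: M.minus_equality)
qed

end

section \<open>Morphisms and subalgebras\<close>

lemma lie_homI:
  assumes "\<And>x. x \<in> carrier A \<Longrightarrow> h x \<in> carrier B"
    and "\<And>x. x \<notin> carrier A \<Longrightarrow> h x = undefined"
    and "\<And>x y. \<lbrakk>x \<in> carrier A; y \<in> carrier A\<rbrakk> \<Longrightarrow> h (x \<oplus>\<^bsub>A\<^esub> y) = h x \<oplus>\<^bsub>B\<^esub> h y"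
    and "\<And>r x. \<lbrakk>r \<in> carrier R; x \<in> carrier A\<rbrakk> \<Longrightarrow> h (r \<odot>\<^bsub>A\<^esub> x) = r \<odot>\<^bsub>B\<^esub> h x"
    and "\<And>x y. \<lbrakk>x \<in> carrier A; y \<in> carrier A\<rbrakk> \<Longrightarrow> h (x \<otimes>\<^bsub>A\<^esub> y) = h x \<otimes>\<^bsub>B\<^esub> h y"
  shows "h \<in> lie_hom R A B"
  using assms unfolding lie_hom_def by (auto intro!: PiE_I)

lemma lie_hom_ext:
  assumes "h \<in> lie_hom R A B" "k \<in> lie_hom R A B" "\<And>x. x \<in> carrier A \<Longrightarrow> h x = k x"
  shows "h = k"
  using assms unfolding lie_hom_def by (auto intro: PiE_ext)

lemma lie_hom_minus:
  assumes "lie_algebra R A" "lie_algebra R B" "h \<in> lie_hom R A B" "x \<in> carrier A"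
  shows "h (\<ominus>\<^bsub>A\<^esub> x) = \<ominus>\<^bsub>B\<^esub> h x"
proof -
  interpret A: lie_algebra R A by fact
  interpret B: lie_algebra R B by fact
  show ?thesis
    using lie_homD(4)[OF assms(3), of "\<ominus>\<^bsub>R\<^esub> \<one>\<^bsub>R\<^esub>" x] lie_homD(1)[OF assms(3,4)] assms(4)
    by (simp add: A.smult_neg_one B.smult_neg_one)
qed

lemma lie_hom_diff:
  assumes "lie_algebra R A" "lie_algebra R B" "h \<in> lie_hom R A B" "x \<in> carrier A" "y \<in> carrier A"
  shows "h (x \<ominus>\<^bsub>A\<^esub> y) = h x \<ominus>\<^bsub>B\<^esub> h y"
proof -
  interpret A: lie_algebra R A by fact
  show ?thesis
    using assms(4,5) by (simp add: a_minus_def lie_homD(3)[OF assms(3)] lie_hom_minus[OF assms(1-3)])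
qed

lemma lie_hom_compose:
  assumes "lie_algebra R A" "f \<in> lie_hom R A B" "g \<in> lie_hom R B C"
  shows "compose (carrier A) g f \<in> lie_hom R A C"
proof -
  interpret A: lie_algebra R A by fact
  show ?thesis
    by (rule lie_homI) (simp_all add: compose_def lie_homD[OF assms(2)] lie_homD[OF assms(3)])
qed

lemma lie_id_hom: "lie_algebra R A \<Longrightarrow> lie_id A \<in> lie_hom R A A"
proof -
  assume "lie_algebra R A"
  then interpret A: lie_algebra R A .
  show ?thesis by (rule lie_homI) (simp_all add: lie_id_def)
qed

lemma lie_zero_hom:
  assumes "lie_algebra R A" "lie_algebra R B"
  shows "lie_zero A B \<in> lie_hom R A B"
proof -
  interpret A: lie_algebra R A by fact
  interpret B: lie_algebra R B by fact
  show ?thesis by (rule lie_homI) (simp_all add: lie_zero_def)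
qed

text \<open>The axioms of the bracket are equations between elements of \<open>L\<close> and so
  restrict to \<open>H\<close>; only closure has to be supplied. This serves for the kernel that
  defines \<open>flat\<close>.\<close>

lemma sub_lie_algebra:
  assumes "lie_algebra R L" "submodule H R L"
    and "\<And>x y. \<lbrakk>x \<in> H; y \<in> H\<rbrakk> \<Longrightarrow> x \<otimes>\<^bsub>L\<^esub> y \<in> H"
  shows "lie_algebra R (L\<lparr>carrier := H\<rparr>)"
proof -
  interpret L: lie_algebra R L by fact
  have "module R (L\<lparr>carrier := H\<rparr>)"
    by (rule submodule.submodule_is_module[OF assms(2) L.module_axioms])
  moreover have "H \<subseteq> carrier L"
    by (rule L.submoduleE(1)[OF assms(2)])
  ultimately show ?thesis
    using assms(3)
    by (intro lie_algebra.intro lie_algebra_axioms.intro)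
      (auto simp: subset_eq L.bracket_add_left L.bracket_add_right L.bracket_smult_left
        L.bracket_smult_right L.bracket_self L.jacobi)
qed


section \<open>Coproducts\<close>

text \<open>Every element is the class of a term, so this is induction on terms. Zero and negatives
  get no case of their own: zero is the image of the zero of \<open>A\<close>, and a negative is a
  multiple by -1.\<close>

lemma coprod_induct [consumes 3, case_names inl inr add smult bracket]:
  assumes A: "lie_algebra R A" and B: "lie_algebra R B" and X: "X \<in> carrier (coprod R A B)"
    and inl: "\<And>a. a \<in> carrier A \<Longrightarrow> Q (inl R A B a)"
    and inr: "\<And>b. b \<in> carrier B \<Longrightarrow> Q (inr R A B b)"
    and add: "\<And>x y. \<lbrakk>x \<in> carrier (coprod R A B); y \<in> carrier (coprod R A B); Q x; Q y\<rbrakk>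
      \<Longrightarrow> Q (x \<oplus>\<^bsub>coprod R A B\<^esub> y)"
    and smult: "\<And>r x. \<lbrakk>r \<in> carrier R; x \<in> carrier (coprod R A B); Q x\<rbrakk>
      \<Longrightarrow> Q (r \<odot>\<^bsub>coprod R A B\<^esub> x)"
    and bracket: "\<And>x y. \<lbrakk>x \<in> carrier (coprod R A B); y \<in> carrier (coprod R A B); Q x; Q y\<rbrakk>
      \<Longrightarrow> Q (x \<otimes>\<^bsub>coprod R A B\<^esub> y)"
  shows "Q X"
proof -
  interpret A: lie_algebra R A by fact
  interpret S: lie_algebra R "coprod R A B" by (rule coprod_lie_algebra[OF A B])
  let ?c = "lie_class R A B"
  obtain s where s: "s \<in> lie_terms R A B" and X: "X = ?c s"
    using X by (auto simp: coprod_carrier)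
  have "Q (?c s)" using s
  proof induction
    case (GenL a)
    then show ?case using inl[of a] by (simp add: inl_def)
  next
    case (GenR b)
    then show ?case using inr[of b] by (simp add: inr_def)
  next
    case Zero
    have "Q (inl R A B \<zero>\<^bsub>A\<^esub>)" by (simp add: inl)
    then show ?case
      using lie_hom_zero[OF A S.lie_algebra_axioms inl_hom[OF A B]] by (simp add: coprod_zero)
  next
    case (Add s t)
    then show ?case using add[of "?c s" "?c t"] by (simp add: coprod_carrier coprod_add)
  next
    case (Neg s)
    then have c: "?c s \<in> carrier (coprod R A B)" "?c (Neg s) \<in> carrier (coprod R A B)"
      by (auto simp: coprod_carrier lie_terms.Neg)
    \<comment> \<open>The relation \<open>add_neg\<close> makes the class of \<open>Neg s\<close> a
      left additive inverse, which by uniqueness is the multiple by -1.\<close>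
    have "?c (Neg s) \<oplus>\<^bsub>coprod R A B\<^esub> ?c s = \<zero>\<^bsub>coprod R A B\<^esub>"
      using Neg by (simp add: coprod_ops lie_terms.intros lie_class_eq_iff lie_cong.add_neg)
    then have "?c (Neg s) = (\<ominus>\<^bsub>R\<^esub> \<one>\<^bsub>R\<^esub>) \<odot>\<^bsub>coprod R A B\<^esub> ?c s"
      using c by (simp add: S.smult_neg_one S.M.minus_equality)
    then show ?case using smult[of "\<ominus>\<^bsub>R\<^esub> \<one>\<^bsub>R\<^esub>" "?c s"] c Neg by simp
  next
    case (Scal r s)
    then show ?case using smult[of r "?c s"] by (simp add: coprod_carrier coprod_smult)
  next
    case (Bracket s t)
    then show ?case using bracket[of "?c s" "?c t"] by (simp add: coprod_carrier coprod_bracket)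
  qed
  then show ?thesis by (simp add: X)
qed

text \<open>The set on which \<open>h\<close> and \<open>k\<close> agree is closed under all
  operations, and the two images generate the coproduct.\<close>

lemma coprod_hom_ext:
  assumes A: "lie_algebra R A" and B: "lie_algebra R B"
    and h: "h \<in> lie_hom R (coprod R A B) C" and k: "k \<in> lie_hom R (coprod R A B) C"
    and "\<And>a. a \<in> carrier A \<Longrightarrow> h (inl R A B a) = k (inl R A B a)"
    and "\<And>b. b \<in> carrier B \<Longrightarrow> h (inr R A B b) = k (inr R A B b)"
  shows "h = k"
proof (rule lie_hom_ext[OF h k])
  fix x assume "x \<in> carrier (coprod R A B)"
  with A B show "h x = k x"
    by (induction rule: coprod_induct) (simp_all add: assms(5,6) lie_homD[OF h] lie_homD[OF k])
qed

text \<open>The universal property justifies the definite description in \<open>copair\<close>. The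
  composites are evaluated pointwise, ready for rewriting.\<close>

lemma copair:
  assumes "lie_algebra R A" "lie_algebra R B" "lie_algebra R C"
    and "f \<in> lie_hom R A C" "g \<in> lie_hom R B C"
  shows copair_hom: "copair R A B C f g \<in> lie_hom R (coprod R A B) C"
    and copair_inl: "a \<in> carrier A \<Longrightarrow> copair R A B C f g (inl R A B a) = f a"
    and copair_inr: "b \<in> carrier B \<Longrightarrow> copair R A B C f g (inr R A B b) = g b"
  using theI'[OF coprod_universal[OF assms], folded copair_def] by (metis compose_eq)+

lemma coprod_swap:
  assumes "lie_algebra R A" "lie_algebra R B"
  shows coprod_swap_hom: "coprod_swap R B A \<in> lie_hom R (coprod R B A) (coprod R A B)"
    and coprod_swap_inl: "b \<in> carrier B \<Longrightarrow> coprod_swap R B A (inl R B A b) = inr R A B b"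
    and coprod_swap_inr: "a \<in> carrier A \<Longrightarrow> coprod_swap R B A (inr R B A a) = inl R A B a"
  using copair[OF assms(2,1) coprod_lie_algebra[OF assms] inr_hom[OF assms] inl_hom[OF assms]]
  by (simp_all add: coprod_swap_def)


section \<open>The object \<open>P \<flat> M\<close>\<close>

lemma carrier_flat:
  "carrier (flat R P M) =
    {x \<in> carrier (coprod R P M). copair R P M P (lie_id P) (lie_zero M P) x = \<zero>\<^bsub>P\<^esub>}"
  by (simp add: flat_def)

lemma flat_ops [simp]:
  "\<zero>\<^bsub>flat R P M\<^esub> = \<zero>\<^bsub>coprod R P M\<^esub>"
  "x \<oplus>\<^bsub>flat R P M\<^esub> y = x \<oplus>\<^bsub>coprod R P M\<^esub> y"
  "r \<odot>\<^bsub>flat R P M\<^esub> x = r \<odot>\<^bsub>coprod R P M\<^esub> x"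
  "x \<otimes>\<^bsub>flat R P M\<^esub> y = x \<otimes>\<^bsub>coprod R P M\<^esub> y"
  by (simp_all add: flat_def)

lemma flat_lie_algebra:
  assumes P: "lie_algebra R P" and M: "lie_algebra R M"
  shows "lie_algebra R (flat R P M)"
proof -
  interpret P: lie_algebra R P by fact
  note S = coprod_lie_algebra[OF P M]
  interpret S: lie_algebra R "coprod R P M" by (rule S)
  note h = copair_hom[OF P M P lie_id_hom[OF P] lie_zero_hom[OF M P]]
  show ?thesis
    unfolding flat_def
    by (intro sub_lie_algebra[OF S] S.submoduleI)
      (auto simp: lie_homD[OF h] lie_hom_zero[OF S P h] lie_hom_minus[OF S P h])
qed

lemma flat_incl_hom:
  assumes "lie_algebra R P" "lie_algebra R M"
  shows "flat_incl R P M \<in> lie_hom R (flat R P M) (coprod R P M)"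
proof -
  interpret F: lie_algebra R "flat R P M" by (rule flat_lie_algebra[OF assms])
  show ?thesis
    using F.M.a_closed F.smult_closed F.bracket_closed
    by (intro lie_homI) (auto simp: flat_incl_def carrier_flat)
qed

lemma inr_in_flat:
  assumes "lie_algebra R P" "lie_algebra R M" "m \<in> carrier M"
  shows "inr R P M m \<in> carrier (flat R P M)"
  using assms lie_homD(1)[OF inr_hom[OF assms(1,2)]]
  by (simp add: carrier_flat copair_inr lie_id_hom lie_zero_hom) (simp add: lie_zero_def)

text \<open>A kernel absorbs brackets: (1, 0) sends [p, x] to a bracket with zero.\<close>

lemma bracket_inl_in_flat:
  assumes P: "lie_algebra R P" and M: "lie_algebra R M"
    and p: "p \<in> carrier P" and x: "x \<in> carrier (flat R P M)"
  shows "inl R P M p \<otimes>\<^bsub>coprod R P M\<^esub> x \<in> carrier (flat R P M)"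
proof -
  interpret P: lie_algebra R P by fact
  interpret S: lie_algebra R "coprod R P M" by (rule coprod_lie_algebra[OF P M])
  note h = copair_hom[OF P M P lie_id_hom[OF P] lie_zero_hom[OF M P]]
  have "inl R P M p \<in> carrier (coprod R P M)"
    using p by (rule lie_homD(1)[OF inl_hom[OF P M]])
  then show ?thesis
    using x lie_homD(1)[OF h] by (simp add: carrier_flat lie_homD(5)[OF h])
qed

text \<open>
  Every element of \<open>P + M\<close> is \<open>p + x\<close> with \<open>p \<in> P\<close> and \<open>x\<close> in the closure of \<open>M\<close> under the
  operations listed in the premises; applying \<open>(1, 0)\<close> to an element of \<open>P \<flat> M\<close> gives \<open>p = 0\<close>.
\<close>

lemma flat_induct [consumes 3, case_names inr add smult bracket bracket_inl]:
  assumes P: "lie_algebra R P" and M: "lie_algebra R M" and X: "X \<in> carrier (flat R P M)"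
    and inr: "\<And>m. m \<in> carrier M \<Longrightarrow> Q (inr R P M m)"
    and add: "\<And>x y. \<lbrakk>x \<in> carrier (flat R P M); y \<in> carrier (flat R P M); Q x; Q y\<rbrakk>
      \<Longrightarrow> Q (x \<oplus>\<^bsub>coprod R P M\<^esub> y)"
    and smult: "\<And>r x. \<lbrakk>r \<in> carrier R; x \<in> carrier (flat R P M); Q x\<rbrakk>
      \<Longrightarrow> Q (r \<odot>\<^bsub>coprod R P M\<^esub> x)"
    and bracket: "\<And>x y. \<lbrakk>x \<in> carrier (flat R P M); y \<in> carrier (flat R P M); Q x; Q y\<rbrakk>
      \<Longrightarrow> Q (x \<otimes>\<^bsub>coprod R P M\<^esub> y)"
    and bracket_inl: "\<And>p x. \<lbrakk>p \<in> carrier P; x \<in> carrier (flat R P M); Q x\<rbrakk>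
      \<Longrightarrow> Q (inl R P M p \<otimes>\<^bsub>coprod R P M\<^esub> x)"
  shows "Q X"
proof -
  interpret P: lie_algebra R P by fact
  interpret M: lie_algebra R M by fact
  note S = coprod_lie_algebra[OF P M]
  interpret S: lie_algebra R "coprod R P M" by (rule S)
  interpret F: lie_algebra R "flat R P M" by (rule flat_lie_algebra[OF P M])
  let ?S = "coprod R P M" and ?i = "inl R P M"
  \<comment> \<open>\<open>T\<close> joins membership in \<open>P \<flat> M\<close> with
    \<open>Q\<close>, so that the premises become closure properties of one set.\<close>
  define T where "T = {x \<in> carrier (flat R P M). Q x}"
  note i = lie_homD[OF inl_hom[OF P M]]
  have T_carrier: "x \<in> carrier ?S" if "x \<in> T" for x
    using that by (simp add: T_def carrier_flat)
  have "inr R P M \<zero>\<^bsub>M\<^esub> = \<zero>\<^bsub>?S\<^esub>"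
    by (rule lie_hom_zero[OF M S inr_hom[OF P M]])
  then have T_zero: "\<zero>\<^bsub>?S\<^esub> \<in> T"
    using inr[of "\<zero>\<^bsub>M\<^esub>"] F.M.zero_closed by (simp add: T_def)
  have T_add: "x \<oplus>\<^bsub>?S\<^esub> y \<in> T" if "x \<in> T" "y \<in> T" for x y
    using that add[of x y] F.M.a_closed[of x y] by (simp add: T_def)
  have T_smult: "r \<odot>\<^bsub>?S\<^esub> x \<in> T" if "r \<in> carrier R" "x \<in> T" for r x
    using that smult[of r x] F.smult_closed[of r x] by (simp add: T_def)
  have T_bracket: "x \<otimes>\<^bsub>?S\<^esub> y \<in> T" if "x \<in> T" "y \<in> T" for x y
    using that bracket[of x y] F.bracket_closed[of x y] by (simp add: T_def)
  have T_inl: "?i p \<otimes>\<^bsub>?S\<^esub> x \<in> T" if "p \<in> carrier P" "x \<in> T" for p x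
    using that bracket_inl[of p x] bracket_inl_in_flat[OF P M] by (simp add: T_def)
  have T_inl': "x \<otimes>\<^bsub>?S\<^esub> ?i p \<in> T" if "p \<in> carrier P" "x \<in> T" for p x
  proof -
    \<comment> \<open>Antisymmetry, with the sign absorbed as the scalar -1, under which
      \<open>T\<close> is closed.\<close>
    have "x \<otimes>\<^bsub>?S\<^esub> ?i p = (\<ominus>\<^bsub>R\<^esub> \<one>\<^bsub>R\<^esub>) \<odot>\<^bsub>?S\<^esub> (?i p \<otimes>\<^bsub>?S\<^esub> x)"
      using that T_carrier i(1) S.bracket_swap[of x "?i p"] by (simp add: S.smult_neg_one)
    then show ?thesis using T_inl[OF that] T_smult by simp
  qed
  \<comment> \<open>The sums of an element of P and an element of \<open>T\<close> include both P
    and M and are closed under the operations. For brackets, [p + x, q + y] differs from [p, q] by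
    [p, y] + [x, q] + [x, y], which lies in \<open>T\<close>.\<close>
  have decomp: "\<exists>p\<in>carrier P. \<exists>x\<in>T. X = ?i p \<oplus>\<^bsub>?S\<^esub> x" if "X \<in> carrier ?S" for X
    using P M that
  proof (induction rule: coprod_induct)
    case (inl p)
    then show ?case using T_zero i(1) by (metis S.M.r_zero)
  next
    case (inr m)
    have "inr R P M m \<in> T"
      using inr assms(4) inr_in_flat[OF P M] by (simp add: T_def)
    moreover have "?i \<zero>\<^bsub>P\<^esub> = \<zero>\<^bsub>?S\<^esub>"
      by (rule lie_hom_zero[OF P S inl_hom[OF P M]])
    ultimately show ?case using T_carrier by (metis P.M.zero_closed S.M.l_zero)
  next
    case (add X Y)
    then obtain p x q y where *: "p \<in> carrier P" "x \<in> T" "X = ?i p \<oplus>\<^bsub>?S\<^esub> x"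
      "q \<in> carrier P" "y \<in> T" "Y = ?i q \<oplus>\<^bsub>?S\<^esub> y" by blast
    then have "X \<oplus>\<^bsub>?S\<^esub> Y = ?i (p \<oplus>\<^bsub>P\<^esub> q) \<oplus>\<^bsub>?S\<^esub> (x \<oplus>\<^bsub>?S\<^esub> y)"
      using i T_carrier by (simp add: S.M.a_ac)
    then show ?case using * T_add by blast
  next
    case (smult r X)
    then obtain p x where *: "p \<in> carrier P" "x \<in> T" "X = ?i p \<oplus>\<^bsub>?S\<^esub> x" by blast
    then have "r \<odot>\<^bsub>?S\<^esub> X = ?i (r \<odot>\<^bsub>P\<^esub> p) \<oplus>\<^bsub>?S\<^esub> r \<odot>\<^bsub>?S\<^esub> x"
      using i T_carrier smult by (simp add: S.smult_r_distr)
    then show ?case using * smult T_smult by blast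
  next
    case (bracket X Y)
    then obtain p x q y where *: "p \<in> carrier P" "x \<in> T" "X = ?i p \<oplus>\<^bsub>?S\<^esub> x"
      "q \<in> carrier P" "y \<in> T" "Y = ?i q \<oplus>\<^bsub>?S\<^esub> y" by blast
    then have "X \<otimes>\<^bsub>?S\<^esub> Y = ?i (p \<otimes>\<^bsub>P\<^esub> q) \<oplus>\<^bsub>?S\<^esub>
        (?i p \<otimes>\<^bsub>?S\<^esub> y \<oplus>\<^bsub>?S\<^esub> (x \<otimes>\<^bsub>?S\<^esub> ?i q \<oplus>\<^bsub>?S\<^esub> x \<otimes>\<^bsub>?S\<^esub> y))"
      using i T_carrier
      by (simp add: S.bracket_add_left S.bracket_add_right S.M.a_ac)
    moreover have "?i p \<otimes>\<^bsub>?S\<^esub> y \<oplus>\<^bsub>?S\<^esub> (x \<otimes>\<^bsub>?S\<^esub> ?i q \<oplus>\<^bsub>?S\<^esub> x \<otimes>\<^bsub>?S\<^esub> y) \<in> T"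
      using * by (intro T_add T_inl T_inl' T_bracket)
    ultimately show ?case using * by blast
  qed
  let ?h = "copair R P M P (lie_id P) (lie_zero M P)"
  note h = copair[OF P M P lie_id_hom[OF P] lie_zero_hom[OF M P]]
  obtain p x where *: "p \<in> carrier P" "x \<in> T" "X = ?i p \<oplus>\<^bsub>?S\<^esub> x"
    using X decomp[of X] by (auto simp: carrier_flat)
  have "?h X = p \<oplus>\<^bsub>P\<^esub> ?h x"
    using * i T_carrier h(2) by (simp add: lie_homD[OF h(1)]) (simp add: lie_id_def)
  then have "p = \<zero>\<^bsub>P\<^esub>"
    using X * by (simp add: T_def carrier_flat)
  then have "X = x"
    using * T_carrier lie_hom_zero[OF P S inl_hom[OF P M]] by simp
  then show ?thesis using * by (simp add: T_def)
qed


section \<open>Semidirect products and internal actions\<close>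

lemma lie_actionD:
  assumes "lie_action R P M act"
  shows "\<lbrakk>p \<in> carrier P; m \<in> carrier M\<rbrakk> \<Longrightarrow> act p m \<in> carrier M"
    and "\<lbrakk>p \<in> carrier P; p' \<in> carrier P; m \<in> carrier M\<rbrakk> \<Longrightarrow>
      act (p \<oplus>\<^bsub>P\<^esub> p') m = act p m \<oplus>\<^bsub>M\<^esub> act p' m"
    and "\<lbrakk>p \<in> carrier P; m \<in> carrier M; m' \<in> carrier M\<rbrakk> \<Longrightarrow>
      act p (m \<oplus>\<^bsub>M\<^esub> m') = act p m \<oplus>\<^bsub>M\<^esub> act p m'"
    and "\<lbrakk>r \<in> carrier R; p \<in> carrier P; m \<in> carrier M\<rbrakk> \<Longrightarrow> act (r \<odot>\<^bsub>P\<^esub> p) m = r \<odot>\<^bsub>M\<^esub> act p m"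
    and "\<lbrakk>r \<in> carrier R; p \<in> carrier P; m \<in> carrier M\<rbrakk> \<Longrightarrow> act p (r \<odot>\<^bsub>M\<^esub> m) = r \<odot>\<^bsub>M\<^esub> act p m"
    and "\<lbrakk>p \<in> carrier P; p' \<in> carrier P; m \<in> carrier M\<rbrakk> \<Longrightarrow>
      act (p \<otimes>\<^bsub>P\<^esub> p') m = act p (act p' m) \<ominus>\<^bsub>M\<^esub> act p' (act p m)"
    and "\<lbrakk>p \<in> carrier P; m \<in> carrier M; m' \<in> carrier M\<rbrakk> \<Longrightarrow>
      act p (m \<otimes>\<^bsub>M\<^esub> m') = act p m \<otimes>\<^bsub>M\<^esub> m' \<oplus>\<^bsub>M\<^esub> m \<otimes>\<^bsub>M\<^esub> act p m'"
  using assms unfolding lie_action_def by blast+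

lemma lie_action_simps:
  assumes "lie_algebra R P" "lie_algebra R M" "lie_action R P M act"
  shows "p \<in> carrier P \<Longrightarrow> act p \<zero>\<^bsub>M\<^esub> = \<zero>\<^bsub>M\<^esub>"
    and "m \<in> carrier M \<Longrightarrow> act \<zero>\<^bsub>P\<^esub> m = \<zero>\<^bsub>M\<^esub>"
    and "\<lbrakk>p \<in> carrier P; m \<in> carrier M; m' \<in> carrier M\<rbrakk> \<Longrightarrow>
      act p (m \<ominus>\<^bsub>M\<^esub> m') = act p m \<ominus>\<^bsub>M\<^esub> act p m'"
proof -
  interpret P: lie_algebra R P by fact
  interpret M: lie_algebra R M by fact
  note act = lie_actionD[OF assms(3)]
  show "act p \<zero>\<^bsub>M\<^esub> = \<zero>\<^bsub>M\<^esub>" if "p \<in> carrier P"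
    using that act(5)[of "\<zero>\<^bsub>R\<^esub>" p "\<zero>\<^bsub>M\<^esub>"] act(1) by simp
  show "act \<zero>\<^bsub>P\<^esub> m = \<zero>\<^bsub>M\<^esub>" if "m \<in> carrier M"
    using that act(4)[of "\<zero>\<^bsub>R\<^esub>" "\<zero>\<^bsub>P\<^esub>" m] act(1) by simp
  show "act p (m \<ominus>\<^bsub>M\<^esub> m') = act p m \<ominus>\<^bsub>M\<^esub> act p m'"
    if "p \<in> carrier P" "m \<in> carrier M" "m' \<in> carrier M"
    using that act(1,3) act(5)[of "\<ominus>\<^bsub>R\<^esub> \<one>\<^bsub>R\<^esub>" p m'] by (simp add: M.M.minus_eq M.smult_neg_one)
qed

text \<open>The semidirect product P \<ltimes> M. For an action, its bracket of (p, 0) and (0, m) is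
  (0, \<open>act p m\<close>), so acting becomes bracketing. The second component of the product is
  a single difference, the normal form of \<open>diff_simps\<close>.\<close>

definition lie_semidirect ::
    "('r, 'p) module \<Rightarrow> ('r, 'm) module \<Rightarrow> ('p \<Rightarrow> 'm \<Rightarrow> 'm) \<Rightarrow> ('r, 'p \<times> 'm) module" where
  "lie_semidirect P M act = \<lparr>
     carrier = carrier P \<times> carrier M,
     mult = (\<lambda>(p, m) (q, n).
       (p \<otimes>\<^bsub>P\<^esub> q, (m \<otimes>\<^bsub>M\<^esub> n \<oplus>\<^bsub>M\<^esub> act p n) \<ominus>\<^bsub>M\<^esub> act q m)),
     one = undefined,
     zero = (\<zero>\<^bsub>P\<^esub>, \<zero>\<^bsub>M\<^esub>),
     add = (\<lambda>(p, m) (q, n). (p \<oplus>\<^bsub>P\<^esub> q, m \<oplus>\<^bsub>M\<^esub> n)),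
     smult = (\<lambda>r (p, m). (r \<odot>\<^bsub>P\<^esub> p, r \<odot>\<^bsub>M\<^esub> m))\<rparr>"

lemma lie_semidirect_simps [simp]:
  "carrier (lie_semidirect P M act) = carrier P \<times> carrier M"
  "\<zero>\<^bsub>lie_semidirect P M act\<^esub> = (\<zero>\<^bsub>P\<^esub>, \<zero>\<^bsub>M\<^esub>)"
  "(p, m) \<oplus>\<^bsub>lie_semidirect P M act\<^esub> (q, n) = (p \<oplus>\<^bsub>P\<^esub> q, m \<oplus>\<^bsub>M\<^esub> n)"
  "r \<odot>\<^bsub>lie_semidirect P M act\<^esub> (p, m) = (r \<odot>\<^bsub>P\<^esub> p, r \<odot>\<^bsub>M\<^esub> m)"
  "(p, m) \<otimes>\<^bsub>lie_semidirect P M act\<^esub> (q, n) =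
    (p \<otimes>\<^bsub>P\<^esub> q, (m \<otimes>\<^bsub>M\<^esub> n \<oplus>\<^bsub>M\<^esub> act p n) \<ominus>\<^bsub>M\<^esub> act q m)"
  by (simp_all add: lie_semidirect_def)

text \<open>In the second component of the Jacobi sum, the terms with three entries from M cancel by
  the Jacobi identity of M, those with two by the derivation rule, and those with one by
  compatibility of the action with the bracket of P.\<close>

lemma lie_semidirect_lie_algebra:
  assumes P: "lie_algebra R P" and M: "lie_algebra R M" and act: "lie_action R P M act"
  shows "lie_algebra R (lie_semidirect P M act)"
proof -
  interpret P: lie_algebra R P by fact
  interpret M: lie_algebra R M by fact
  note act' = lie_actionD[OF act] lie_action_simps[OF P M act]
  let ?L = "lie_semidirect P M act"
  have "abelian_group ?L"
  proof (rule abelian_groupI)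
    fix x assume "x \<in> carrier ?L"
    then obtain p m where "x = (p, m)" "p \<in> carrier P" "m \<in> carrier M" by auto
    then show "\<exists>y\<in>carrier ?L. y \<oplus>\<^bsub>?L\<^esub> x = \<zero>\<^bsub>?L\<^esub>"
      by (intro bexI[of _ "(\<ominus>\<^bsub>P\<^esub> p, \<ominus>\<^bsub>M\<^esub> m)"]) (simp_all add: P.M.l_neg M.M.l_neg)
  qed (auto simp: P.M.a_ac M.M.a_ac)
  then have "module R ?L"
    by (intro moduleI P.R.is_cring)
      (auto simp: P.smult_l_distr M.smult_l_distr P.smult_r_distr M.smult_r_distr
        P.smult_assoc1 M.smult_assoc1)
  moreover have "lie_algebra_axioms R ?L"
  proof
    fix x y z assume "x \<in> carrier ?L" "y \<in> carrier ?L" "z \<in> carrier ?L"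
    then obtain p m q n s l where [simp]: "x = (p, m)" "y = (q, n)" "z = (s, l)"
      and c: "p \<in> carrier P" "q \<in> carrier P" "s \<in> carrier P"
        "m \<in> carrier M" "n \<in> carrier M" "l \<in> carrier M"
      by auto
    note [simp] = c M.M.diff_simps act'
    show "x \<otimes>\<^bsub>?L\<^esub> y \<in> carrier ?L" by simp
    show "(x \<oplus>\<^bsub>?L\<^esub> y) \<otimes>\<^bsub>?L\<^esub> z = x \<otimes>\<^bsub>?L\<^esub> z \<oplus>\<^bsub>?L\<^esub> y \<otimes>\<^bsub>?L\<^esub> z"
      by (simp add: P.bracket_add_left M.bracket_add_left M.M.a_ac)
    show "x \<otimes>\<^bsub>?L\<^esub> (y \<oplus>\<^bsub>?L\<^esub> z) = x \<otimes>\<^bsub>?L\<^esub> y \<oplus>\<^bsub>?L\<^esub> x \<otimes>\<^bsub>?L\<^esub> z"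
      by (simp add: P.bracket_add_right M.bracket_add_right M.M.a_ac)
    show "x \<otimes>\<^bsub>?L\<^esub> x = \<zero>\<^bsub>?L\<^esub>"
      by (simp add: P.bracket_self M.bracket_self)
    \<comment> \<open>The derivation rule yields brackets with the transformed element on the left.
      Antisymmetry moves it to the right, where these terms meet their counterparts of opposite
      sign.\<close>
    have swap: "act p n \<otimes>\<^bsub>M\<^esub> l = \<zero>\<^bsub>M\<^esub> \<ominus>\<^bsub>M\<^esub> l \<otimes>\<^bsub>M\<^esub> act p n"
      "act q l \<otimes>\<^bsub>M\<^esub> m = \<zero>\<^bsub>M\<^esub> \<ominus>\<^bsub>M\<^esub> m \<otimes>\<^bsub>M\<^esub> act q l"
      "act s m \<otimes>\<^bsub>M\<^esub> n = \<zero>\<^bsub>M\<^esub> \<ominus>\<^bsub>M\<^esub> n \<otimes>\<^bsub>M\<^esub> act s m"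
      using M.bracket_swap[of "act p n" l] M.bracket_swap[of "act q l" m]
        M.bracket_swap[of "act s m" n] by (simp_all add: M.M.minus_eq del: M.M.diff_simps)
    \<comment> \<open>This accounts for the part of the second component in which the action does
      not occur.\<close>
    have "m \<otimes>\<^bsub>M\<^esub> (n \<otimes>\<^bsub>M\<^esub> l) = \<zero>\<^bsub>M\<^esub> \<ominus>\<^bsub>M\<^esub> (n \<otimes>\<^bsub>M\<^esub> (l \<otimes>\<^bsub>M\<^esub> m) \<oplus>\<^bsub>M\<^esub> l \<otimes>\<^bsub>M\<^esub> (m \<otimes>\<^bsub>M\<^esub> n))"
      using M.jacobi[of m n l] by (simp add: M.M.a_assoc)
    then show "x \<otimes>\<^bsub>?L\<^esub> (y \<otimes>\<^bsub>?L\<^esub> z) \<oplus>\<^bsub>?L\<^esub> y \<otimes>\<^bsub>?L\<^esub> (z \<otimes>\<^bsub>?L\<^esub> x)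
        \<oplus>\<^bsub>?L\<^esub> z \<otimes>\<^bsub>?L\<^esub> (x \<otimes>\<^bsub>?L\<^esub> y) = \<zero>\<^bsub>?L\<^esub>"
      using P.jacobi[of p q s]
      by (simp add: M.bracket_add_right M.bracket_diff_right swap M.M.a_ac)
    fix r assume "r \<in> carrier R"
    note [simp] = this
    show "(r \<odot>\<^bsub>?L\<^esub> x) \<otimes>\<^bsub>?L\<^esub> y = r \<odot>\<^bsub>?L\<^esub> (x \<otimes>\<^bsub>?L\<^esub> y)"
      by (simp add: P.bracket_smult_left M.bracket_smult_left M.smult_diff_right M.smult_r_distr)
    show "x \<otimes>\<^bsub>?L\<^esub> (r \<odot>\<^bsub>?L\<^esub> y) = r \<odot>\<^bsub>?L\<^esub> (x \<otimes>\<^bsub>?L\<^esub> y)"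
      by (simp add: P.bracket_smult_right M.bracket_smult_right M.smult_diff_right M.smult_r_distr)
  qed
  ultimately show ?thesis by (rule lie_algebra.intro)
qed

text \<open>Existence: the morphism from P + M to P \<ltimes> M maps \<open>P \<flat> M\<close> into
  the kernel of the first projection, a copy of M, and its second component is \<xi>. Uniqueness:
  the conditions prescribe the value in each case of \<open>flat_induct\<close>.\<close>

lemma internal_action_unique_exists:
  assumes P: "lie_algebra R P" and M: "lie_algebra R M" and act: "lie_action R P M act"
  shows "\<exists>!\<xi>. \<xi> \<in> lie_hom R (flat R P M) M \<and>
     (\<forall>m\<in>carrier M. \<xi> (inr R P M m) = m) \<and>
     (\<forall>p\<in>carrier P. \<forall>x\<in>carrier (flat R P M).
        \<xi> (inl R P M p \<otimes>\<^bsub>coprod R P M\<^esub> x) = act p (\<xi> x))"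
    (is "\<exists>!\<xi>. ?\<Phi> \<xi>")
proof (rule ex_ex1I)
  interpret P: lie_algebra R P by fact
  interpret M: lie_algebra R M by fact
  note S = coprod_lie_algebra[OF P M] and F = flat_lie_algebra[OF P M]
  interpret F: lie_algebra R "flat R P M" by (rule F)
  note act' = lie_actionD[OF act] lie_action_simps[OF P M act]
  let ?L = "lie_semidirect P M act"
  note L = lie_semidirect_lie_algebra[OF P M act]
  have i: "(\<lambda>p\<in>carrier P. (p, \<zero>\<^bsub>M\<^esub>)) \<in> lie_hom R P ?L"
    by (rule lie_homI) (simp_all add: act' M.M.diff_simps)
  have j: "(\<lambda>m\<in>carrier M. (\<zero>\<^bsub>P\<^esub>, m)) \<in> lie_hom R M ?L"
    by (rule lie_homI) (simp_all add: act' M.M.diff_simps)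
  have pr: "restrict fst (carrier ?L) \<in> lie_hom R ?L P"
    by (rule lie_homI) (auto simp: act')
  define h where
    "h = copair R P M ?L (\<lambda>p\<in>carrier P. (p, \<zero>\<^bsub>M\<^esub>)) (\<lambda>m\<in>carrier M. (\<zero>\<^bsub>P\<^esub>, m))"
  note h = copair[OF P M L i j, folded h_def]
  note hD = lie_homD[OF h(1)]
  note k = copair[OF P M P lie_id_hom[OF P] lie_zero_hom[OF M P]]
  \<comment> \<open>The first component of \<open>h\<close> is (1, 0), since both agree on
    generators; hence it vanishes on \<open>P \<flat> M\<close>.\<close>
  have fst_h: "compose (carrier (coprod R P M)) (restrict fst (carrier ?L)) h =
      copair R P M P (lie_id P) (lie_zero M P)"
    using lie_homD(1)[OF inl_hom[OF P M]] lie_homD(1)[OF inr_hom[OF P M]]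
    by (intro coprod_hom_ext[OF P M lie_hom_compose[OF S h(1) pr] k(1)])
      (simp_all add: compose_def h(2,3) k(2,3), simp_all add: lie_id_def lie_zero_def)
  have fst: "fst (h x) = copair R P M P (lie_id P) (lie_zero M P) x"
    if "x \<in> carrier (coprod R P M)" for x
    using that hD(1)[OF that] fun_cong[OF fst_h, of x] by (simp add: compose_eq)
  define \<xi> where "\<xi> = (\<lambda>x\<in>carrier (flat R P M). snd (h x))"
  have \<xi>: "\<xi> x \<in> carrier M" "h x = (\<zero>\<^bsub>P\<^esub>, \<xi> x)" "x \<in> carrier (coprod R P M)"
    if "x \<in> carrier (flat R P M)" for x
    using that fst[of x] hD(1)[of x] by (auto simp: \<xi>_def carrier_flat prod_eq_iff)
  \<comment> \<open>The value of \<xi> at a compound element is read off as the second component of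
    \<open>h\<close>, where the operations of the semidirect product apply.\<close>
  note \<xi>_eq = \<xi>(2)[THEN arg_cong[of _ _ snd], symmetric]
  have "\<xi> \<in> lie_hom R (flat R P M) M"
  proof (rule lie_homI)
    fix x y assume xy: "x \<in> carrier (flat R P M)" "y \<in> carrier (flat R P M)"
    then show "\<xi> (x \<oplus>\<^bsub>flat R P M\<^esub> y) = \<xi> x \<oplus>\<^bsub>M\<^esub> \<xi> y"
      using \<xi>_eq[OF F.M.a_closed[OF xy]] by (simp add: \<xi> hD)
    show "\<xi> (x \<otimes>\<^bsub>flat R P M\<^esub> y) = \<xi> x \<otimes>\<^bsub>M\<^esub> \<xi> y"
      using \<xi>_eq[OF F.bracket_closed[OF xy]] xy by (simp add: \<xi> hD act' M.M.diff_simps)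
  next
    fix r x assume rx: "r \<in> carrier R" "x \<in> carrier (flat R P M)"
    then show "\<xi> (r \<odot>\<^bsub>flat R P M\<^esub> x) = r \<odot>\<^bsub>M\<^esub> \<xi> x"
      using \<xi>_eq[OF F.smult_closed[OF rx]] by (simp add: \<xi> hD)
  qed (simp_all add: \<xi>, simp add: \<xi>_def)
  moreover have "\<xi> (inr R P M m) = m" if "m \<in> carrier M" for m
    using that \<xi>_eq[OF inr_in_flat[OF P M that]] by (simp add: h(3))
  \<comment> \<open>Here \<open>h\<close> sends p to (p, 0) and x to (0, \<xi> x), and the bracket
    of these pairs is (0, \<open>act p (\<xi> x)\<close>).\<close>
  moreover have "\<xi> (inl R P M p \<otimes>\<^bsub>coprod R P M\<^esub> x) = act p (\<xi> x)"
    if "p \<in> carrier P" "x \<in> carrier (flat R P M)" for p x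
    using that \<xi>_eq[OF bracket_inl_in_flat[OF P M that]] lie_homD(1)[OF inl_hom[OF P M]]
    by (simp add: \<xi> hD h(2) act' M.M.diff_simps)
  ultimately show "\<exists>\<xi>. ?\<Phi> \<xi>" by blast
  fix \<xi> \<zeta> assume *: "?\<Phi> \<xi>" "?\<Phi> \<zeta>"
  then have \<xi>: "\<xi> \<in> lie_hom R (flat R P M) M" and \<zeta>: "\<zeta> \<in> lie_hom R (flat R P M) M"
    by blast+
  show "\<xi> = \<zeta>"
  proof (rule lie_hom_ext[OF \<xi> \<zeta>])
    fix x assume "x \<in> carrier (flat R P M)"
    with P M show "\<xi> x = \<zeta> x"
      by (induction rule: flat_induct)
        (use * lie_homD(3-5)[OF \<xi>] lie_homD(3-5)[OF \<zeta>] in auto)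
  qed
qed

lemma internal_action:
  assumes "lie_algebra R P" "lie_algebra R M" "lie_action R P M act"
  shows internal_action_hom: "internal_action R P M act \<in> lie_hom R (flat R P M) M"
    and internal_action_inr: "m \<in> carrier M \<Longrightarrow> internal_action R P M act (inr R P M m) = m"
    and internal_action_bracket_inl: "\<lbrakk>p \<in> carrier P; x \<in> carrier (flat R P M)\<rbrakk> \<Longrightarrow>
      internal_action R P M act (inl R P M p \<otimes>\<^bsub>coprod R P M\<^esub> x) =
      act p (internal_action R P M act x)"
  using theI'[OF internal_action_unique_exists[OF assms], folded internal_action_def] by blast+

text \<open>Both sides are morphisms on \<open>P \<flat> M\<close> that agree on M, so in
  \<open>flat_induct\<close> only the case [p, x] draws on the condition about the action.\<close>

lemma copair_eq_internal_action_iff: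
  assumes P: "lie_algebra R P" and M: "lie_algebra R M" and C: "lie_algebra R C"
    and act: "lie_action R P M act"
    and f: "f \<in> lie_hom R P C" and g: "g \<in> lie_hom R M C"
  shows "(\<forall>x\<in>carrier (flat R P M). copair R P M C f g x = g (internal_action R P M act x)) \<longleftrightarrow>
    (\<forall>p\<in>carrier P. \<forall>m\<in>carrier M. f p \<otimes>\<^bsub>C\<^esub> g m = g (act p m))"
proof (intro iffI ballI)
  note h = copair[OF P M C f g] and hD = lie_homD[OF copair_hom[OF P M C f g]]
  note \<xi> = internal_action[OF P M act] and \<xi>D = lie_homD[OF internal_action_hom[OF P M act], simplified]
  note i = lie_homD[OF inl_hom[OF P M]] and gD = lie_homD[OF g]
  have flat: "x \<in> carrier (coprod R P M)" if "x \<in> carrier (flat R P M)" for x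
    using that by (simp add: carrier_flat)
  {
    fix p m assume pm: "p \<in> carrier P" "m \<in> carrier M"
      and *: "\<forall>x\<in>carrier (flat R P M). copair R P M C f g x = g (internal_action R P M act x)"
    \<comment> \<open>The test element is [p, m]: the induced morphism sends it to [f p, g m], and
      \<xi> sends it to \<open>act p m\<close>.\<close>
    have m: "inr R P M m \<in> carrier (flat R P M)" by (rule inr_in_flat[OF P M pm(2)])
    then have "inl R P M p \<otimes>\<^bsub>coprod R P M\<^esub> inr R P M m \<in> carrier (flat R P M)"
      by (rule bracket_inl_in_flat[OF P M pm(1)])
    with * show "f p \<otimes>\<^bsub>C\<^esub> g m = g (act p m)"
      using pm m flat i by (metis h(2,3) hD(5) \<xi>(2,3))
  next
    fix x assume x: "x \<in> carrier (flat R P M)"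
      and *: "\<forall>p\<in>carrier P. \<forall>m\<in>carrier M. f p \<otimes>\<^bsub>C\<^esub> g m = g (act p m)"
    from P M x show "copair R P M C f g x = g (internal_action R P M act x)"
    proof (induction rule: flat_induct)
      case (inr m)
      then show ?case by (simp add: h \<xi>)
    next
      case (bracket_inl p x)
      \<comment> \<open>By the induction hypothesis the left side is [f p, g (\<xi> x)], and the
        condition applies to the element \<xi> x of M.\<close>
      then show ?case using * by (simp add: hD h i flat \<xi> \<xi>D)
    qed (simp_all add: hD \<xi>D gD flat)
  }
qed


section \<open>Ideals and quotients\<close>

text \<open>This gives access to the calculus of additive cosets for Lie ideals.\<close>

lemma lie_ideal_abelian_subgroup:
  assumes "lie_algebra R L" "lie_ideal R L I"
  shows "abelian_subgroup I L"
proof -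
  interpret L: lie_algebra R L by fact
  have "submodule I R L" using assms(2) by (simp add: lie_ideal_def)
  then interpret submodule I R L .
  show ?thesis
    by (intro abelian_subgroupI3 additive_subgroup.intro subgroup_axioms L.M.abelian_group_axioms)
qed

lemma lie_ideal_kernel:
  assumes L: "lie_algebra R L" and C: "lie_algebra R C" and h: "h \<in> lie_hom R L C"
  shows "lie_ideal R L {x \<in> carrier L. h x = \<zero>\<^bsub>C\<^esub>}"
proof -
  interpret L: lie_algebra R L by fact
  interpret C: lie_algebra R C by fact
  show ?thesis
    unfolding lie_ideal_def
    by (auto intro!: L.submoduleI simp: lie_homD[OF h] lie_hom_zero[OF L C h] lie_hom_minus[OF L C h])
qed

lemma gen_lie_ideal:
  assumes "lie_algebra R L" "S \<subseteq> carrier L"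
  shows lie_ideal_gen_lie_ideal: "lie_ideal R L (gen_lie_ideal R L S)"
    and subset_gen_lie_ideal: "S \<subseteq> gen_lie_ideal R L S"
proof -
  interpret L: lie_algebra R L by fact
  \<comment> \<open>The whole algebra is an ideal containing \<open>S\<close>, which keeps the
    intersection inside the carrier.\<close>
  have carrier: "lie_ideal R L (carrier L)"
    using L.carrier_is_submodule by (simp add: lie_ideal_def)
  show "S \<subseteq> gen_lie_ideal R L S"
    unfolding gen_lie_ideal_def by blast
  have sub: "submodule I R L" if "lie_ideal R L I" for I
    using that by (simp add: lie_ideal_def)
  have bracket: "x \<otimes>\<^bsub>L\<^esub> y \<in> I" "y \<otimes>\<^bsub>L\<^esub> x \<in> I" if "lie_ideal R L I" "x \<in> carrier L" "y \<in> I" for I x y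
    using that by (simp_all add: lie_ideal_def)
  have zero: "\<zero>\<^bsub>L\<^esub> \<in> I" if "lie_ideal R L I" for I
    using additive_subgroup.zero_closed abelian_subgroup.axioms(1)
      lie_ideal_abelian_subgroup[OF assms(1) that] by blast
  show "lie_ideal R L (gen_lie_ideal R L S)"
    unfolding lie_ideal_def
  proof (intro conjI ballI L.submoduleI)
    show "gen_lie_ideal R L S \<subseteq> carrier L"
      using carrier assms(2) by (auto simp: gen_lie_ideal_def)
  qed (use L.submoduleE(3-5)[OF sub] bracket zero in \<open>auto simp: gen_lie_ideal_def\<close>)
qed

lemma gen_lie_ideal_least: "\<lbrakk>lie_ideal R L I; S \<subseteq> I\<rbrakk> \<Longrightarrow> gen_lie_ideal R L S \<subseteq> I"
  unfolding gen_lie_ideal_def by blast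

text \<open>The kernel of \<open>h\<close> is an ideal, so it contains the generated ideal as soon
  as it contains \<open>S\<close>.\<close>

lemma hom_vanishes_on_gen_lie_ideal_iff:
  assumes "lie_algebra R L" "lie_algebra R C" "h \<in> lie_hom R L C" "S \<subseteq> carrier L"
  shows "(\<forall>x\<in>gen_lie_ideal R L S. h x = \<zero>\<^bsub>C\<^esub>) \<longleftrightarrow> (\<forall>x\<in>S. h x = \<zero>\<^bsub>C\<^esub>)"
  using gen_lie_ideal_least[OF lie_ideal_kernel[OF assms(1-3)], of S]
    subset_gen_lie_ideal[OF assms(1,4)] assms(4) by blast

text \<open>Scalar multiples and brackets of cosets are unions over representatives; independence of
  the representatives makes these unions constant. Afterwards one computes with representatives
  only.\<close>

lemma lie_quot_simps:
  assumes L: "lie_algebra R L" and I: "lie_ideal R L I"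
  shows carrier_lie_quot: "carrier (lie_quot L I) = (\<lambda>x. I +>\<^bsub>L\<^esub> x) ` carrier L"
    and coset_eq_iff: "\<lbrakk>x \<in> carrier L; y \<in> carrier L\<rbrakk> \<Longrightarrow>
      I +>\<^bsub>L\<^esub> x = I +>\<^bsub>L\<^esub> y \<longleftrightarrow> x \<ominus>\<^bsub>L\<^esub> y \<in> I"
    and lie_quot_zero: "\<zero>\<^bsub>lie_quot L I\<^esub> = I +>\<^bsub>L\<^esub> \<zero>\<^bsub>L\<^esub>"
    and lie_quot_add: "\<lbrakk>x \<in> carrier L; y \<in> carrier L\<rbrakk> \<Longrightarrow>
      (I +>\<^bsub>L\<^esub> x) \<oplus>\<^bsub>lie_quot L I\<^esub> (I +>\<^bsub>L\<^esub> y) = I +>\<^bsub>L\<^esub> (x \<oplus>\<^bsub>L\<^esub> y)"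
    and lie_quot_smult: "\<lbrakk>r \<in> carrier R; x \<in> carrier L\<rbrakk> \<Longrightarrow>
      r \<odot>\<^bsub>lie_quot L I\<^esub> (I +>\<^bsub>L\<^esub> x) = I +>\<^bsub>L\<^esub> (r \<odot>\<^bsub>L\<^esub> x)"
    and lie_quot_bracket: "\<lbrakk>x \<in> carrier L; y \<in> carrier L\<rbrakk> \<Longrightarrow>
      (I +>\<^bsub>L\<^esub> x) \<otimes>\<^bsub>lie_quot L I\<^esub> (I +>\<^bsub>L\<^esub> y) = I +>\<^bsub>L\<^esub> (x \<otimes>\<^bsub>L\<^esub> y)"
proof -
  interpret L: lie_algebra R L by fact
  interpret I: abelian_subgroup I L by (rule lie_ideal_abelian_subgroup[OF L I])
  have smult: "r \<odot>\<^bsub>L\<^esub> x \<in> I" if "r \<in> carrier R" "x \<in> I" for r x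
    using that I L.submoduleE(4) by (auto simp: lie_ideal_def)
  have bracket: "x \<otimes>\<^bsub>L\<^esub> y \<in> I" "y \<otimes>\<^bsub>L\<^esub> x \<in> I" if "x \<in> carrier L" "y \<in> I" for x y
    using that I by (simp_all add: lie_ideal_def)
  have in_coset: "a \<in> I +>\<^bsub>L\<^esub> x \<longleftrightarrow> a \<in> carrier L \<and> a \<ominus>\<^bsub>L\<^esub> x \<in> I" if "x \<in> carrier L" for a x
    using that I.a_rcos_module[of x a] I.a_elemrcos_carrier[of x a] by (auto simp: a_minus_def)
  show coset_eq: "I +>\<^bsub>L\<^esub> x = I +>\<^bsub>L\<^esub> y \<longleftrightarrow> x \<ominus>\<^bsub>L\<^esub> y \<in> I"
    if "x \<in> carrier L" "y \<in> carrier L" for x y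
    using that in_coset[of y x] I.a_repr_independence'[of x y] I.a_repr_independenceD[of x y]
    by metis
  show "carrier (lie_quot L I) = (\<lambda>x. I +>\<^bsub>L\<^esub> x) ` carrier L"
    by (auto simp: lie_quot_def A_RCOSETS_def')
  show "\<zero>\<^bsub>lie_quot L I\<^esub> = I +>\<^bsub>L\<^esub> \<zero>\<^bsub>L\<^esub>"
    using I.a_subset by (simp add: lie_quot_def)
  show "(I +>\<^bsub>L\<^esub> x) \<oplus>\<^bsub>lie_quot L I\<^esub> (I +>\<^bsub>L\<^esub> y) = I +>\<^bsub>L\<^esub> (x \<oplus>\<^bsub>L\<^esub> y)"
    if "x \<in> carrier L" "y \<in> carrier L" for x y
    using that by (simp add: lie_quot_def I.a_rcos_sum)
  show "r \<odot>\<^bsub>lie_quot L I\<^esub> (I +>\<^bsub>L\<^esub> x) = I +>\<^bsub>L\<^esub> (r \<odot>\<^bsub>L\<^esub> x)"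
    if r: "r \<in> carrier R" and x: "x \<in> carrier L" for r x
  proof -
    \<comment> \<open>The difference of the two multiples is r times a - x, which lies in
      \<open>I\<close>.\<close>
    have "I +>\<^bsub>L\<^esub> (r \<odot>\<^bsub>L\<^esub> a) = I +>\<^bsub>L\<^esub> (r \<odot>\<^bsub>L\<^esub> x)" if "a \<in> I +>\<^bsub>L\<^esub> x" for a
      using that r x smult[of r "a \<ominus>\<^bsub>L\<^esub> x"] by (simp add: in_coset coset_eq L.smult_diff_right)
    then have "(\<Union>a\<in>I +>\<^bsub>L\<^esub> x. I +>\<^bsub>L\<^esub> (r \<odot>\<^bsub>L\<^esub> a)) = I +>\<^bsub>L\<^esub> (r \<odot>\<^bsub>L\<^esub> x)"
      by (intro ballI UN_constant_eq[OF I.a_rcos_self[OF x]])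
    then show ?thesis by (simp add: lie_quot_def)
  qed
  show "(I +>\<^bsub>L\<^esub> x) \<otimes>\<^bsub>lie_quot L I\<^esub> (I +>\<^bsub>L\<^esub> y) = I +>\<^bsub>L\<^esub> (x \<otimes>\<^bsub>L\<^esub> y)"
    if x: "x \<in> carrier L" and y: "y \<in> carrier L" for x y
  proof -
    have "I +>\<^bsub>L\<^esub> (a \<otimes>\<^bsub>L\<^esub> b) = I +>\<^bsub>L\<^esub> (x \<otimes>\<^bsub>L\<^esub> y)" if "a \<in> I +>\<^bsub>L\<^esub> x" "b \<in> I +>\<^bsub>L\<^esub> y" for a b
    proof -
      have ab: "a \<in> carrier L" "b \<in> carrier L" "a \<ominus>\<^bsub>L\<^esub> x \<in> I" "b \<ominus>\<^bsub>L\<^esub> y \<in> I"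
        using that x y by (simp_all add: in_coset)
      \<comment> \<open>The representatives are replaced one at a time: first [a - x, b] and then
        [x, b - y] lies in \<open>I\<close>.\<close>
      then have "I +>\<^bsub>L\<^esub> (a \<otimes>\<^bsub>L\<^esub> b) = I +>\<^bsub>L\<^esub> (x \<otimes>\<^bsub>L\<^esub> b)"
        using bracket(2)[of b "a \<ominus>\<^bsub>L\<^esub> x"] x by (simp add: coset_eq L.bracket_diff_left)
      also have "\<dots> = I +>\<^bsub>L\<^esub> (x \<otimes>\<^bsub>L\<^esub> y)"
        using ab bracket(1)[of x "b \<ominus>\<^bsub>L\<^esub> y"] x y by (simp add: coset_eq L.bracket_diff_right)
      finally show ?thesis .
    qed
    then have "(\<Union>a\<in>I +>\<^bsub>L\<^esub> x. \<Union>b\<in>I +>\<^bsub>L\<^esub> y. I +>\<^bsub>L\<^esub> (a \<otimes>\<^bsub>L\<^esub> b)) = I +>\<^bsub>L\<^esub> (x \<otimes>\<^bsub>L\<^esub> y)"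
      by (intro ballI UN_constant_eq[OF I.a_rcos_self[OF x]] UN_constant_eq[OF I.a_rcos_self[OF y]])
    then show ?thesis by (simp add: lie_quot_def rcoset_mult_def)
  qed
qed

lemma lie_quot_lie_algebra:
  assumes L: "lie_algebra R L" and I: "lie_ideal R L I"
  shows "lie_algebra R (lie_quot L I)"
proof -
  interpret L: lie_algebra R L by fact
  note [simp] = lie_quot_zero[OF L I] lie_quot_add[OF L I] lie_quot_smult[OF L I]
    lie_quot_bracket[OF L I]
  note carrier = carrier_lie_quot[OF L I]
  \<comment> \<open>The identity is nested to the right, the shape into which \<open>a_ac\<close>
    brings the sum.\<close>
  have jacobi: "x \<otimes>\<^bsub>L\<^esub> (y \<otimes>\<^bsub>L\<^esub> z) \<oplus>\<^bsub>L\<^esub> (y \<otimes>\<^bsub>L\<^esub> (z \<otimes>\<^bsub>L\<^esub> x) \<oplus>\<^bsub>L\<^esub> z \<otimes>\<^bsub>L\<^esub> (x \<otimes>\<^bsub>L\<^esub> y)) = \<zero>\<^bsub>L\<^esub>"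
    if "x \<in> carrier L" "y \<in> carrier L" "z \<in> carrier L" for x y z
    using that L.jacobi[of x y z] by (simp add: L.M.a_assoc)
  show ?thesis
  proof (intro lie_algebra.intro lie_algebra_axioms.intro moduleI abelian_groupI L.R.is_cring)
    fix X assume "X \<in> carrier (lie_quot L I)"
    then obtain x where "x \<in> carrier L" "X = I +>\<^bsub>L\<^esub> x" by (auto simp: carrier)
    then show "\<exists>Y\<in>carrier (lie_quot L I). Y \<oplus>\<^bsub>lie_quot L I\<^esub> X = \<zero>\<^bsub>lie_quot L I\<^esub>"
      by (intro bexI[of _ "I +>\<^bsub>L\<^esub> (\<ominus>\<^bsub>L\<^esub> x)"]) (simp_all add: carrier L.M.l_neg)
  qed (auto simp: carrier L.M.a_ac L.smult_l_distr L.smult_r_distr L.smult_assoc1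
      L.bracket_add_left L.bracket_add_right L.bracket_smult_left L.bracket_smult_right
      L.bracket_self jacobi)
qed

lemma quot_map_hom:
  assumes L: "lie_algebra R L" and I: "lie_ideal R L I"
  shows "quot_map L I \<in> lie_hom R L (lie_quot L I)"
proof -
  interpret L: lie_algebra R L by fact
  show ?thesis
    by (rule lie_homI) (simp_all add: quot_map_def lie_quot_simps[OF L I])
qed

lemma quot_map_eq_zero:
  assumes L: "lie_algebra R L" and I: "lie_ideal R L I" and x: "x \<in> I"
  shows "quot_map L I x = \<zero>\<^bsub>lie_quot L I\<^esub>"
proof -
  interpret L: lie_algebra R L by fact
  interpret I: abelian_subgroup I L by (rule lie_ideal_abelian_subgroup[OF L I])
  show ?thesis
    using x I.a_rcos_const by (simp add: quot_map_def lie_quot_def)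
qed

text \<open>The factorization evaluates \<open>h\<close> at a chosen representative. It is unique
  because every element of the quotient is the coset of some element of \<open>L\<close>.\<close>

lemma lie_quot_universal:
  assumes L: "lie_algebra R L" and I: "lie_ideal R L I" and C: "lie_algebra R C"
    and h: "h \<in> lie_hom R L C" and vanish: "\<forall>x\<in>I. h x = \<zero>\<^bsub>C\<^esub>"
  shows "\<exists>!u. u \<in> lie_hom R (lie_quot L I) C \<and> compose (carrier L) u (quot_map L I) = h"
proof (rule ex_ex1I)
  interpret L: lie_algebra R L by fact
  interpret C: lie_algebra R C by fact
  note hD = lie_homD[OF h] and carrier = carrier_lie_quot[OF L I]
  define u where
    "u = (\<lambda>X\<in>carrier (lie_quot L I). h (SOME x. x \<in> carrier L \<and> I +>\<^bsub>L\<^esub> x = X))"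
  have u: "u (I +>\<^bsub>L\<^esub> x) = h x" if x: "x \<in> carrier L" for x
  proof -
    define y where "y = (SOME y. y \<in> carrier L \<and> I +>\<^bsub>L\<^esub> y = I +>\<^bsub>L\<^esub> x)"
    have y: "y \<in> carrier L" "I +>\<^bsub>L\<^esub> y = I +>\<^bsub>L\<^esub> x"
      using someI[of "\<lambda>y. y \<in> carrier L \<and> I +>\<^bsub>L\<^esub> y = I +>\<^bsub>L\<^esub> x" x] x by (simp_all add: y_def)
    \<comment> \<open>Two representatives of a coset differ by an element of \<open>I\<close>, which
      \<open>h\<close> kills.\<close>
    then have "h y \<ominus>\<^bsub>C\<^esub> h x = \<zero>\<^bsub>C\<^esub>"
      using x vanish coset_eq_iff[OF L I y(1) x] lie_hom_diff[OF L C h y(1) x] by simp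
    then have "h y = h x" using x y hD(1) by (simp add: C.M.diff_simps)
    then show ?thesis using x by (simp add: u_def y_def carrier)
  qed
  have "u \<in> lie_hom R (lie_quot L I) C"
    by (rule lie_homI) (auto simp: carrier u hD lie_quot_simps[OF L I], simp add: u_def carrier)
  moreover have "compose (carrier L) u (quot_map L I) = h"
    using hD(2) by (auto simp: compose_def quot_map_def u)
  ultimately show
    "\<exists>u. u \<in> lie_hom R (lie_quot L I) C \<and> compose (carrier L) u (quot_map L I) = h" by blast
  fix u v
  assume u: "u \<in> lie_hom R (lie_quot L I) C \<and> compose (carrier L) u (quot_map L I) = h"
    and v: "v \<in> lie_hom R (lie_quot L I) C \<and> compose (carrier L) v (quot_map L I) = h"
  then have "u (I +>\<^bsub>L\<^esub> x) = v (I +>\<^bsub>L\<^esub> x)" if "x \<in> carrier L" for x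
    using that by (metis compose_eq quot_map_def restrict_apply')
  then show "u = v"
    using u v by (intro lie_hom_ext[of u R "lie_quot L I" C v]) (auto simp: carrier)
qed


section \<open>The Peiffer product\<close>

locale mutual_lie_actions =
  fixes R :: "('r, 'x) ring_scheme"
    and M :: "('r, 'm) module" and N :: "('r, 'n) module"
    and actMN :: "'m \<Rightarrow> 'n \<Rightarrow> 'n" and actNM :: "'n \<Rightarrow> 'm \<Rightarrow> 'm"
  assumes M: "lie_algebra R M" and N: "lie_algebra R N"
    and actMN: "lie_action R M N actMN" and actNM: "lie_action R N M actNM"
begin

abbreviation "K \<equiv> peiffer_ideal R M N actMN actNM"

abbreviation "coeq_dom \<equiv> coprod R (flat R N M) (flat R M N)"

text \<open>The inclusion of \<open>N \<flat> M\<close> takes values in N + M; the swap carries them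
  to M + N, where the other inclusion already lands.\<close>

abbreviation "coeq_fst \<equiv> copair R (flat R N M) (flat R M N) (coprod R M N)
  (compose (carrier (flat R N M)) (coprod_swap R N M) (flat_incl R N M)) (flat_incl R M N)"

abbreviation "coeq_snd \<equiv> coprod_map R (flat R N M) (flat R M N) M N
  (internal_action R N M actNM) (internal_action R M N actMN)"

lemmas MN = coprod_lie_algebra[OF M N]

sublocale MN: lie_algebra R "coprod R M N"
  by (rule MN)

lemmas flats = flat_lie_algebra[OF N M] flat_lie_algebra[OF M N]

lemmas inclusions = lie_homD[OF inl_hom[OF M N]] lie_homD[OF inr_hom[OF M N]]

lemma coeq_fst:
  shows coeq_fst_hom: "coeq_fst \<in> lie_hom R coeq_dom (coprod R M N)"
    and coeq_fst_inl: "x \<in> carrier (flat R N M) \<Longrightarrow>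
      coeq_fst (inl R (flat R N M) (flat R M N) x) = coprod_swap R N M x"
    and coeq_fst_inr: "y \<in> carrier (flat R M N) \<Longrightarrow>
      coeq_fst (inr R (flat R N M) (flat R M N) y) = y"
  using copair[OF flats MN lie_hom_compose[OF flats(1) flat_incl_hom[OF N M]
        coprod_swap_hom[OF M N]] flat_incl_hom[OF M N]]
  by (simp_all add: compose_def flat_incl_def)

lemma coeq_snd:
  shows coeq_snd_hom: "coeq_snd \<in> lie_hom R coeq_dom (coprod R M N)"
    and coeq_snd_inl: "x \<in> carrier (flat R N M) \<Longrightarrow>
      coeq_snd (inl R (flat R N M) (flat R M N) x) = inl R M N (internal_action R N M actNM x)"
    and coeq_snd_inr: "y \<in> carrier (flat R M N) \<Longrightarrow>
      coeq_snd (inr R (flat R N M) (flat R M N) y) = inr R M N (internal_action R M N actMN y)"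
  using copair[OF flats MN
      lie_hom_compose[OF flats(1) internal_action_hom[OF N M actNM] inl_hom[OF M N]]
      lie_hom_compose[OF flats(2) internal_action_hom[OF M N actMN] inr_hom[OF M N]]]
  by (simp_all add: compose_def coprod_map_def)

text \<open>The two composites are compared on each summand of the domain. On both summands the
  comparison is between an induced morphism and a component of \<open>h\<close> after an internal
  action, so \<open>copair_eq_internal_action_iff\<close> applies twice.\<close>

lemma coequalizes_iff:
  assumes C: "lie_algebra R C" and h: "h \<in> lie_hom R (coprod R M N) C"
  shows "compose (carrier coeq_dom) h coeq_fst = compose (carrier coeq_dom) h coeq_snd \<longleftrightarrow>
    (\<forall>n\<in>carrier N. \<forall>m\<in>carrier M.
      h (inr R M N n) \<otimes>\<^bsub>C\<^esub> h (inl R M N m) = h (inl R M N (actNM n m))) \<and>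
    (\<forall>m\<in>carrier M. \<forall>n\<in>carrier N.
      h (inl R M N m) \<otimes>\<^bsub>C\<^esub> h (inr R M N n) = h (inr R M N (actMN m n)))"
proof -
  let ?F = "flat R N M" and ?G = "flat R M N"
  let ?f = "compose (carrier M) h (inl R M N)" and ?g = "compose (carrier N) h (inr R M N)"
  note f = lie_hom_compose[OF M inl_hom[OF M N] h] and g = lie_hom_compose[OF N inr_hom[OF M N] h]
  note dom = coprod_lie_algebra[OF flats]
  note hf = lie_hom_compose[OF dom coeq_fst_hom h] and hg = lie_hom_compose[OF dom coeq_snd_hom h]
  note i = lie_homD(1)[OF inl_hom[OF flats]] lie_homD(1)[OF inr_hom[OF flats]]
  \<comment> \<open>After the swap, \<open>h\<close> is induced by the same two components in the
    opposite order, as needed on \<open>N \<flat> M\<close>.\<close>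
  have swap: "compose (carrier (coprod R N M)) h (coprod_swap R N M) = copair R N M C ?g ?f"
    using lie_homD(1)[OF inl_hom[OF N M]] lie_homD(1)[OF inr_hom[OF N M]]
    by (intro coprod_hom_ext[OF N M lie_hom_compose[OF coprod_lie_algebra[OF N M]
            coprod_swap_hom[OF M N] h] copair_hom[OF N M C g f]])
      (simp_all add: compose_def coprod_swap[OF M N] copair[OF N M C g f, unfolded compose_def])
  have id: "h = copair R M N C ?f ?g"
    by (intro coprod_hom_ext[OF M N h copair_hom[OF M N C f g]])
      (simp_all add: compose_def copair[OF M N C f g, unfolded compose_def])
  \<comment> \<open>Since the domain is a coproduct, equality of the composites is tested on the
    images of its two summands.\<close>
  have "compose (carrier coeq_dom) h coeq_fst = compose (carrier coeq_dom) h coeq_snd \<longleftrightarrow>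
      (\<forall>x\<in>carrier ?F. h (coeq_fst (inl R ?F ?G x)) = h (coeq_snd (inl R ?F ?G x))) \<and>
      (\<forall>y\<in>carrier ?G. h (coeq_fst (inr R ?F ?G y)) = h (coeq_snd (inr R ?F ?G y)))"
    (is "?L = ?R \<longleftrightarrow> ?A")
  proof
    assume eq: "?L = ?R"
    have "h (coeq_fst X) = h (coeq_snd X)" if "X \<in> carrier coeq_dom" for X
      using fun_cong[OF eq, of X] that by (simp add: compose_eq)
    then show ?A using i by blast
  next
    assume ?A
    then show "?L = ?R"
      using i by (intro coprod_hom_ext[OF flats hf hg]) (simp_all add: compose_eq)
  qed
  also have "\<dots> \<longleftrightarrow>
      (\<forall>x\<in>carrier ?F. copair R N M C ?g ?f x = ?f (internal_action R N M actNM x)) \<and>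
      (\<forall>y\<in>carrier ?G. copair R M N C ?f ?g y = ?g (internal_action R M N actMN y))"
  proof -
    have "copair R N M C ?g ?f x = h (coprod_swap R N M x)" if "x \<in> carrier ?F" for x
      using that by (simp add: swap[symmetric] compose_eq carrier_flat)
    then show ?thesis
      using lie_homD(1)[OF internal_action_hom[OF N M actNM]]
        lie_homD(1)[OF internal_action_hom[OF M N actMN]]
      by (simp add: coeq_fst_inl coeq_fst_inr coeq_snd_inl coeq_snd_inr id[symmetric] compose_eq)
  qed
  also have "\<dots> \<longleftrightarrow>
      (\<forall>n\<in>carrier N. \<forall>m\<in>carrier M. ?g n \<otimes>\<^bsub>C\<^esub> ?f m = ?f (actNM n m)) \<and>
      (\<forall>m\<in>carrier M. \<forall>n\<in>carrier N. ?f m \<otimes>\<^bsub>C\<^esub> ?g n = ?g (actMN m n))"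
    unfolding copair_eq_internal_action_iff[OF N M C actNM g f]
      copair_eq_internal_action_iff[OF M N C actMN f g] ..
  finally show ?thesis
    using lie_actionD(1)[OF actNM] lie_actionD(1)[OF actMN] by (simp add: compose_eq)
qed

text \<open>This repeats the generating set inside \<open>peiffer_ideal\<close>, so that the facts
  on generated ideals match after unfolding.\<close>

abbreviation "peiffer_gens \<equiv>
  {inl R M N (actNM n m) \<ominus>\<^bsub>coprod R M N\<^esub> inr R M N n \<otimes>\<^bsub>coprod R M N\<^esub> inl R M N m
    | m n. m \<in> carrier M \<and> n \<in> carrier N} \<union>
  {inr R M N (actMN m n) \<ominus>\<^bsub>coprod R M N\<^esub> inl R M N m \<otimes>\<^bsub>coprod R M N\<^esub> inr R M N n
    | m n. m \<in> carrier M \<and> n \<in> carrier N}"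

lemma peiffer_gens_carrier: "peiffer_gens \<subseteq> carrier (coprod R M N)"
  using inclusions lie_actionD(1)[OF actNM] lie_actionD(1)[OF actMN] by auto

lemma peiffer_ideal: "lie_ideal R (coprod R M N) K"
  unfolding peiffer_ideal_def by (rule lie_ideal_gen_lie_ideal[OF MN peiffer_gens_carrier])

text \<open>A difference is killed by \<open>h\<close> iff its two terms have the same image, which
  turns the generators of \<open>K\<close> into the equations of \<open>coequalizes_iff\<close>. One
  direction serves for the quotient map, the other for test morphisms.\<close>

lemma vanishes_on_peiffer_ideal_iff:
  assumes C: "lie_algebra R C" and h: "h \<in> lie_hom R (coprod R M N) C"
  shows "(\<forall>x\<in>K. h x = \<zero>\<^bsub>C\<^esub>) \<longleftrightarrow>
    compose (carrier coeq_dom) h coeq_fst = compose (carrier coeq_dom) h coeq_snd"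
proof -
  interpret C: lie_algebra R C by fact
  note hD = lie_homD[OF h] lie_hom_diff[OF MN C h]
  have "h (inl R M N (actNM n m) \<ominus>\<^bsub>coprod R M N\<^esub> inr R M N n \<otimes>\<^bsub>coprod R M N\<^esub> inl R M N m) = \<zero>\<^bsub>C\<^esub>
      \<longleftrightarrow> h (inr R M N n) \<otimes>\<^bsub>C\<^esub> h (inl R M N m) = h (inl R M N (actNM n m))"
    "h (inr R M N (actMN m n) \<ominus>\<^bsub>coprod R M N\<^esub> inl R M N m \<otimes>\<^bsub>coprod R M N\<^esub> inr R M N n) = \<zero>\<^bsub>C\<^esub>
      \<longleftrightarrow> h (inl R M N m) \<otimes>\<^bsub>C\<^esub> h (inr R M N n) = h (inr R M N (actMN m n))"
    if "m \<in> carrier M" "n \<in> carrier N" for m n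
    using that lie_actionD(1)[OF actNM] lie_actionD(1)[OF actMN]
    by (auto simp: hD inclusions C.M.diff_simps)
  note eq = this
  have "(\<forall>x\<in>K. h x = \<zero>\<^bsub>C\<^esub>) \<longleftrightarrow> (\<forall>x\<in>peiffer_gens. h x = \<zero>\<^bsub>C\<^esub>)"
    unfolding peiffer_ideal_def
    by (rule hom_vanishes_on_gen_lie_ideal_iff[OF MN C h peiffer_gens_carrier])
  also have "\<dots> \<longleftrightarrow> compose (carrier coeq_dom) h coeq_fst = compose (carrier coeq_dom) h coeq_snd"
    unfolding coequalizes_iff[OF C h] using eq by blast
  finally show ?thesis .
qed

end

theorem mainTheorem4:
  fixes R :: "('r, 'x) ring_scheme"
    and M :: "('r, 'm) module" and N :: "('r, 'n) module"
    and actMN :: "'m \<Rightarrow> 'n \<Rightarrow> 'n" and actNM :: "'n \<Rightarrow> 'm \<Rightarrow> 'm"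
  assumes "cring R" and "lie_algebra R M" and "lie_algebra R N"
    and "lie_action R M N actMN" and "lie_action R N M actNM"
  shows "is_lie_coequalizer TYPE('c) R
    (coprod R (flat R N M) (flat R M N)) (coprod R M N)
    (copair R (flat R N M) (flat R M N) (coprod R M N)
      (compose (carrier (flat R N M)) (coprod_swap R N M) (flat_incl R N M))
      (flat_incl R M N))
    (coprod_map R (flat R N M) (flat R M N) M N
      (internal_action R N M actNM) (internal_action R M N actMN))
    (peiffer_product R M N actMN actNM) (peiffer_quot_map R M N actMN actNM)"
proof -
  interpret mutual_lie_actions R M N actMN actNM
    using assms(2-5) by (rule mutual_lie_actions.intro)
  note Q = lie_quot_lie_algebra[OF MN peiffer_ideal] and q = quot_map_hom[OF MN peiffer_ideal]
  \<comment> \<open>The quotient map kills \<open>K\<close>, hence it equalizes the pair.\<close>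
  have "compose (carrier coeq_dom) (quot_map (coprod R M N) K) coeq_fst =
      compose (carrier coeq_dom) (quot_map (coprod R M N) K) coeq_snd"
    using quot_map_eq_zero[OF MN peiffer_ideal] vanishes_on_peiffer_ideal_iff[OF Q q] by blast
  \<comment> \<open>A test morphism that equalizes the pair kills \<open>K\<close>, hence it factors
    uniquely through the quotient.\<close>
  moreover have "\<exists>!u. u \<in> lie_hom R (lie_quot (coprod R M N) K) C \<and>
      compose (carrier (coprod R M N)) u (quot_map (coprod R M N) K) = h"
    if "lie_algebra R C" "h \<in> lie_hom R (coprod R M N) C"
      "compose (carrier coeq_dom) h coeq_fst = compose (carrier coeq_dom) h coeq_snd"
    for C :: "('r, 'c) module" and h
    using that vanishes_on_peiffer_ideal_iff[OF that(1,2)]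
    by (intro lie_quot_universal[OF MN peiffer_ideal]) blast+
  ultimately show ?thesis
    unfolding is_lie_coequalizer_def peiffer_product_def peiffer_quot_map_def
    using coprod_lie_algebra[OF flats] MN coeq_fst_hom coeq_snd_hom Q q by blast
qed

end
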